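(* Let $n\ge 2$. For any pair of positive integers $1\le \ell<k\le n$, the off-shell Bethe vector $\mathcal{Z}_\ell^k\cdot\mathbb{B}(\bar t)$ of the generic $\mathfrak{gl}_n$-invariant integrable model satisfies the rectangular recurrence relation $$\mathcal{Z}_\ell^{k}\cdot \mathbb{B}(\bar t)=\mathbb{B}\bigl(\{\bar t^s\}_1^{\ell-1},\{\bar u^{s}\}_\ell^{k-1},\{\bar t^s\}_k^{n-1}\bigr)=\frac{1}{\mu^k_\ell(z;\bar t)}\sum_{i=1}^\ell\sum_{j=k}^n \sum_{\rm part}\Xi^{\ell,k}_{i,j}(z;\bar t_{\rm I},\bar t_{\rm II},\bar t_{\rm III})\,T_{i,j}(z)\cdot\mathbb{B}(\bar t_{\rm II}),$$ where $$\Xi^{\ell,k}_{i,j}(z;\bar t_{\rm I},\bar t_{\rm II},\bar t_{\rm III})=g(z,\bar t^{\ell-1}_{\rm I})\,g(\bar t^k_{\rm III},z)\prod_{s=i}^{\ell-1}\Omega^R\bigl(\bar t^s_{\rm I},\bar t^s_{\rm II}\,|\,\bar t^{s-1}_{\rm II},\bar t^{s+1}_{\rm II}\bigr)\prod_{s=k}^{j-1}\alpha_s(\bar t^s_{\rm III})\,\Omega^L\bigl(\bar t^s_{\rm II},\bar t^s_{\rm III}\,|\,\bar t^{s-1}_{\rm II},\bar t^{s+1}_{\rm II}\bigr),$$ and, for each $(i,j)$, the sum $\sum_{\rm part}$ goes over partitions $\{\bar t^s_{\rm I},\bar t^s_{\rm II},\bar t^s_{\rm III}\}\vdash\bar t^s$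 ($s=1,\dots,n-1$) with cardinalities $$|\bar t^s_{\rm I}|=\begin{cases}\Theta(s-i),&s<\ell,\\0,&s\ge\ell,\end{cases}\qquad |\bar t^s_{\rm III}|=\begin{cases}0,&s\le k-1,\\ \Theta(j-s-1),&s>k-1.\end{cases}$$ The sets $\bar t^\ell,\dots,\bar t^{k-1}$ are not partitioned: in particular $\bar t^\ell_{\rm II}=\bar t^\ell$ and $\bar t^{k-1}_{\rm II}=\bar t^{k-1}$. If $\bar t^s=\varnothing$ for some $s$ and the cardinality rule ($|\bar t^s_{\rm I}|=\Theta(s-i)$ for $s<\ell$ and $0$ for $s\ge\ell$; $|\bar t^s_{\rm III}|=0$ for $s\le k-1$ and $\Theta(j-s-1)$ for $s>k-1$) gives $|\bar t^s_{\rm I}|=1$ for some $i$ or $|\bar t^s_{\rm III}|=1$ for some $j$, then the terms on the right-hand side with such values of $i$ and $j$ are discarded.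
   Context: **Model.** $c\neq0$ is a fixed parameter. The monodromy matrix $T(u)=(T_{i,j}(u))_{1\le i,j\le n}$ has operator entries satisfying $$[T_{i,j}(u),T_{k,l}(v)]=\frac{c}{u-v}\bigl(T_{k,j}(v)T_{i,l}(u)-T_{k,j}(u)T_{i,l}(v)\bigr)$$ (Yangian $Y(\mathfrak{gl}_n)$), with expansion $T_{i,j}(u)=\chi_i\delta_{ij}+\sum_{m\ge0}T_{i,j}[m](u/c)^{-m-1}$, where $\chi_1,\dots,\chi_n$ are independent (generic nonzero) twisting parameters. The zero modes are $\mathsf{T}_{i,j}:=T_{i,j}[0]$. There is a vacuum vector $|0\rangle$ with $T_{i,j}(z)|0\rangle=0$ for $i>j$ and $T_{i,i}(z)|0\rangle=\lambda_i(z)|0\rangle$; the $\lambda_i$ are free (independent) functional parameters. Put $\alpha_s(z)=\lambda_s(z)/\lambda_{s+1}(z)$. **Functions.** $g(u,v)=\frac{c}{u-v}$, $f(u,v)=\frac{u-v+c}{u-v}$, $h(u,v)=\frac{f(u,v)}{g(u,v)}=\frac{u-v+c}{c}$, $\gamma(u,v)=\frac{g(u,v)}{h(v,u)}$. A function of one or two variables evaluated on sets denotes the product over all elements (pairs of elements) of the sets, e.g. $\lambda_s(\bar t)=\prod_{t\in\bar t}\lambda_s(t)$, $f(\bar x,\bar y)=\prod_{x\in\bar x}\prod_{y\in\bar y}f(x,y)$; products over empty sets equal $1$. $\Theta(m)=1$ for integer $m\ge0$ and $\Theta(m)=0$ for $m<0$. $$\Omega^L(\bar x,\bar y|\bar a,\bar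 b)=\gamma(\bar x,\bar y)\frac{h(\bar y,\bar a)}{g(\bar b,\bar y)},\qquad \Omega^R(\bar y,\bar x|\bar a,\bar b)=\gamma(\bar y,\bar x)\frac{h(\bar b,\bar y)}{g(\bar y,\bar a)}.$$ For $1\le\ell<k\le n$: $\mu_\ell^k(z;\bar t)=\lambda_k(z)\,g(z,\bar t^{\ell-1})\,h(\bar t^\ell,z)\,h(z,\bar t^{k-1})\,g(\bar t^k,z)$. **Bethe parameters and partitions.** $\bar t=\{\bar t^1,\dots,\bar t^{n-1}\}$ is a collection of finite sets of generic parameters, $\bar t^s=\{t^s_1,\dots,t^s_{r_s}\}$ (the set of colour $s$), $|\bar t^s|=r_s\ge0$, with the convention $\bar t^0=\bar t^n=\varnothing$. $\{\bar t^s\}_i^j$ denotes $\bar t^i,\bar t^{i+1},\dots,\bar t^j$ (empty if $j<i$). For a generic parameter $z$, $\bar u^s=\{\bar t^s,z\}=\bar t^s\cup\{z\}$. A partition $\{\bar t^s_{\rm I},\bar t^s_{\rm II},\bar t^s_{\rm III}\}\vdash\bar t^s$ is a decomposition into pairwise disjoint, possibly empty subsets with union $\bar t^s$. $\bar t_{\rm II}=\{\bar t^1_{\rm II},\dots,\bar t^{n-1}_{\rm II}\}$, and similarly for I, III. **Off-shell Bethe vectors.** $\mathbb{B}(\bar t)=\mathcal{B}(\bar t)|0\rangle$ denotes the off-shell Bethe vectors of the model: $\mathcal{B}(\bar t)$ is a polynomial in the entries $T_{i,j}$, $i<j$, at Bethe parameters (fixed by the nested algebraic Bethe ansatz), $\mathbb{B}$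 depends on each $\bar t^s$ only as a set, $\mathbb{B}(\varnothing)=|0\rangle$. They are normalized so that $$T_{1,n}(z)\cdot\mathbb{B}(\bar t)=\mu_1^n(z;\bar t)\,\mathbb{B}(\bar u),\qquad \bar u=\{\bar u^1,\dots,\bar u^{n-1}\},$$ and the zero modes act by (for $1\le\ell\le n-1$) $$\mathsf{T}_{\ell+1,\ell}\cdot\mathbb{B}(\bar t)=\sum\Bigl(\chi_{\ell+1}\alpha_\ell(\bar t^\ell_{\rm I})\,\Omega^L(\bar t^\ell_{\rm II},\bar t^\ell_{\rm I}|\bar t^{\ell-1},\bar t^{\ell+1})-\chi_\ell\,\Omega^R(\bar t^\ell_{\rm I},\bar t^\ell_{\rm II}|\bar t^{\ell-1},\bar t^{\ell+1})\Bigr)\mathbb{B}\bigl(\{\bar t^s\}_1^{\ell-1},\bar t^\ell_{\rm II},\{\bar t^s\}_{\ell+1}^{n-1}\bigr),$$ the sum being over partitions $\{\bar t^\ell_{\rm I},\bar t^\ell_{\rm II}\}\vdash\bar t^\ell$ with $|\bar t^\ell_{\rm I}|=1$. These two action formulas are known properties of the Bethe vectors and are taken as given. **Operation $\mathcal{Z}$.** $\mathcal{Z}_\ell^k\cdot\mathbb{B}(\bar t)=\mathbb{B}\bigl(\{\bar t^s\}_1^{\ell-1},\{\bar t^s,z\}_\ell^{k-1},\{\bar t^s\}_k^{n-1}\bigr)$, i.e. the parameter $z$ is added to each of the sets $\bar t^\ell,\dots,\bar t^{k-1}$. *)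

theory Defs
  imports Complex_Main
begin

section \<open>Scalar functions and their products over sets\<close>

definition prod1 :: "(complex \<Rightarrow> complex) \<Rightarrow> complex set \<Rightarrow> complex" where
  "prod1 F X = (\<Prod>x\<in>X. F x)"

definition prod2 :: "(complex \<Rightarrow> complex \<Rightarrow> complex) \<Rightarrow> complex set \<Rightarrow> complex set \<Rightarrow> complex" where
  "prod2 F X Y = (\<Prod>x\<in>X. \<Prod>y\<in>Y. F x y)"

definition g :: "complex \<Rightarrow> complex \<Rightarrow> complex \<Rightarrow> complex" where
  "g c u v = c / (u - v)"

text \<open>This is \<open>f / g\<close> with \<open>f u v = (u - v + c) / (u - v)\<close>, written in cancelled form so that it
  has the correct value \<open>1\<close> at \<open>u = v\<close>.\<close>

definition h :: "complex \<Rightarrow> complex \<Rightarrow> complex \<Rightarrow> complex" where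
  "h c u v = (u - v + c) / c"

definition gam :: "complex \<Rightarrow> complex \<Rightarrow> complex \<Rightarrow> complex" where
  "gam c u v = g c u v / h c v u"

definition alpha :: "(nat \<Rightarrow> complex \<Rightarrow> complex) \<Rightarrow> nat \<Rightarrow> complex \<Rightarrow> complex" where
  "alpha lam s z = lam s z / lam (s + 1) z"

definition Theta :: "int \<Rightarrow> nat" where
  "Theta m = (if m \<ge> 0 then 1 else 0)"

text \<open>The factors \<open>1 / g\<close> below couple parameters of neighbouring colours, which are allowed to
  coincide.  Since \<open>1 / g u v = (u - v) / c\<close>, the correct value at \<open>u = v\<close> is \<open>0\<close>; this is also what
  division by zero yields here.\<close>

definition OmegaL ::
  "complex \<Rightarrow> complex set \<Rightarrow> complex set \<Rightarrow> complex set \<Rightarrow> complex set \<Rightarrow> complex" where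
  "OmegaL c x y a b = prod2 (gam c) x y * (prod2 (h c) y a / prod2 (g c) b y)"

definition OmegaR ::
  "complex \<Rightarrow> complex set \<Rightarrow> complex set \<Rightarrow> complex set \<Rightarrow> complex set \<Rightarrow> complex" where
  "OmegaR c y x a b = prod2 (gam c) y x * (prod2 (h c) b y / prod2 (g c) y a)"

section \<open>Collections of Bethe parameters\<close>

text \<open>A collection of Bethe parameters is a function from colours to sets, with empty values outside
  \<open>{1..<n}\<close>; in particular the sets of colours \<open>0\<close> and \<open>n\<close> are empty.\<close>

type_synonym params = "nat \<Rightarrow> complex set"

definition mu ::
  "complex \<Rightarrow> (nat \<Rightarrow> complex \<Rightarrow> complex) \<Rightarrow> nat \<Rightarrow> nat \<Rightarrow> complex \<Rightarrow> params \<Rightarrow> complex" where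
  "mu c lam l k z t =
     lam k z * prod2 (g c) {z} (t (l - 1)) * prod2 (h c) (t l) {z}
       * prod2 (h c) {z} (t (k - 1)) * prod2 (g c) (t k) {z}"

definition add_param :: "nat \<Rightarrow> nat \<Rightarrow> complex \<Rightarrow> params \<Rightarrow> params" where
  "add_param l k z t = (\<lambda>s. if l \<le> s \<and> s \<le> k - 1 then t s \<union> {z} else t s)"

definition Zop :: "nat \<Rightarrow> nat \<Rightarrow> complex \<Rightarrow> (params \<Rightarrow> 'v) \<Rightarrow> params \<Rightarrow> 'v" where
  "Zop l k z B t = B (add_param l k z t)"

text \<open>Parameters at which Bethe vectors and the coefficients of the zero mode action are regular:
  only parameters of equal colour have to avoid each other and each other's shifts by \<open>c\<close>.
  Parameters of different colours may coincide, as they do after adding one \<open>z\<close> to several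
  colours.  \<open>D\<close> is the set of spectral parameters at which the monodromy matrix is defined.\<close>

definition admissible ::
  "nat \<Rightarrow> complex \<Rightarrow> complex set \<Rightarrow> (nat \<Rightarrow> complex \<Rightarrow> complex) \<Rightarrow> params \<Rightarrow> bool" where
  "admissible n c D lam t \<longleftrightarrow>
     (\<forall>s. s \<notin> {1..<n} \<longrightarrow> t s = {}) \<and>
     (\<forall>s. finite (t s)) \<and>
     (\<forall>s. \<forall>x\<in>t s. x \<in> D \<and> (\<forall>i\<in>{1..n}. lam i x \<noteq> 0)) \<and>
     (\<forall>s. \<forall>x\<in>t s. \<forall>y\<in>t s. x - y \<noteq> c)"

text \<open>Full genericity of \<open>t\<close> together with a further parameter \<open>z\<close>: all parameters, of whatever
  colour, are distinct and do not differ by \<open>c\<close>.\<close>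

definition generic_params ::
  "nat \<Rightarrow> complex \<Rightarrow> complex set \<Rightarrow> (nat \<Rightarrow> complex \<Rightarrow> complex) \<Rightarrow> complex \<Rightarrow> params \<Rightarrow> bool" where
  "generic_params n c D lam z t \<longleftrightarrow>
     admissible n c D lam t \<and>
     (\<forall>r s. r \<noteq> s \<longrightarrow> (\<forall>x\<in>t r. \<forall>y\<in>t s. x \<noteq> y \<and> x - y \<noteq> c)) \<and>
     z \<in> D \<and> (\<forall>i\<in>{1..n}. lam i z \<noteq> 0) \<and>
     (\<forall>s. \<forall>x\<in>t s. x \<noteq> z \<and> x - z \<noteq> c \<and> z - x \<noteq> c)"

definition partitions2 :: "complex set \<Rightarrow> (complex set \<times> complex set) set" where
  "partitions2 X = {(X1, X2). X1 \<union> X2 = X \<and> X1 \<inter> X2 = {}}"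

text \<open>If \<open>t s\<close> is too small for the prescribed cardinalities, this set is empty, so that the
  corresponding terms of a sum over it are discarded.\<close>

definition partitions3 ::
  "nat \<Rightarrow> nat \<Rightarrow> nat \<Rightarrow> nat \<Rightarrow> nat \<Rightarrow> params \<Rightarrow> (params \<times> params \<times> params) set" where
  "partitions3 n l k i j t =
     {(tI, tII, tIII).
        (\<forall>s. tI s \<union> tII s \<union> tIII s = t s \<and>
             tI s \<inter> tII s = {} \<and> tI s \<inter> tIII s = {} \<and> tII s \<inter> tIII s = {}) \<and>
        (\<forall>s\<in>{1..<n}.
             card (tI s) = (if s < l then Theta (int s - int i) else 0) \<and>
             card (tIII s) = (if s \<le> k - 1 then 0 else Theta (int j - int s - 1)))}"

lemma finite_partitions3:
  assumes "admissible n c D lam t"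
  shows "finite (partitions3 n l k i j t)"
proof -
  let ?F = "{f :: params. \<forall>s. (s \<in> {1..<n} \<longrightarrow> f s \<in> Pow (\<Union>r\<in>{1..<n}. t r)) \<and>
                              (s \<notin> {1..<n} \<longrightarrow> f s = {})}"
  have t: "\<And>s. s \<notin> {1..<n} \<Longrightarrow> t s = {}" "\<And>s. finite (t s)"
    using assms unfolding admissible_def by blast+
  have F: "finite ?F"
    by (rule finite_set_of_finite_funs) (auto simp: t(2))
  have mem: "f \<in> ?F" if "\<And>s. f s \<subseteq> t s" for f
    using that t(1) by blast
  have "partitions3 n l k i j t \<subseteq> ?F \<times> ?F \<times> ?F"
  proof (rule subsetI)
    fix p assume p: "p \<in> partitions3 n l k i j t"
    obtain a b d where abd: "p = (a, b, d)" by (cases p)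
    have "a s \<union> b s \<union> d s = t s" for s
      using p unfolding abd partitions3_def by simp
    then have "a \<in> ?F" "b \<in> ?F" "d \<in> ?F"
      by (intro mem; blast)+
    then show "p \<in> ?F \<times> ?F \<times> ?F" unfolding abd by blast
  qed
  then show ?thesis using F by (meson finite_SigmaI finite_subset)
qed

definition Xi ::
  "complex \<Rightarrow> (nat \<Rightarrow> complex \<Rightarrow> complex) \<Rightarrow> nat \<Rightarrow> nat \<Rightarrow> nat \<Rightarrow> nat \<Rightarrow> complex \<Rightarrow>
   params \<Rightarrow> params \<Rightarrow> params \<Rightarrow> complex" where
  "Xi c lam l k i j z tI tII tIII =
     prod2 (g c) {z} (tI (l - 1)) * prod2 (g c) (tIII k) {z}
     * (\<Prod>s=i..<l. OmegaR c (tI s) (tII s) (tII (s - 1)) (tII (s + 1)))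
     * (\<Prod>s=k..<j. prod1 (alpha lam s) (tIII s)
                     * OmegaL c (tII s) (tIII s) (tII (s - 1)) (tII (s + 1)))"

section \<open>The integrable model\<close>

text \<open>The monodromy matrix acts on a Hausdorff topological complex vector space.  Its expansion at
  infinity is read as an asymptotic expansion, which every convergent expansion is; \<open>Tm i j m\<close> is
  the coefficient of \<open>(u / c)\<close> to the power \<open>-m-1\<close>, and \<open>Tm i j 0\<close> are the zero modes.\<close>

locale gl_model = vector_space scale
  for scale :: "complex \<Rightarrow> 'v::{topological_ab_group_add,t2_space} \<Rightarrow> 'v" (infixr "*s" 75) +
  fixes n :: nat
    and c :: complex
    and chi :: "nat \<Rightarrow> complex"
    and D :: "complex set"
    and T :: "nat \<Rightarrow> nat \<Rightarrow> complex \<Rightarrow> 'v \<Rightarrow> 'v"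
    and Tm :: "nat \<Rightarrow> nat \<Rightarrow> nat \<Rightarrow> 'v \<Rightarrow> 'v"
    and vac :: 'v
    and lam :: "nat \<Rightarrow> complex \<Rightarrow> complex"
  assumes n_ge_2: "n \<ge> 2"
    and c_nonzero: "c \<noteq> 0"
    and chi_nonzero: "i \<in> {1..n} \<Longrightarrow> chi i \<noteq> 0"
    and continuous_scale: "continuous_on UNIV (\<lambda>p. fst p *s snd p)"
    and D_infinity: "\<forall>\<^sub>F u in at_infinity. u \<in> D"
    and linear_T: "\<lbrakk>i \<in> {1..n}; j \<in> {1..n}; u \<in> D\<rbrakk> \<Longrightarrow> Vector_Spaces.linear (*s) (*s) (T i j u)"
    and continuous_T: "\<lbrakk>i \<in> {1..n}; j \<in> {1..n}; u \<in> D\<rbrakk> \<Longrightarrow> continuous_on UNIV (T i j u)"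
    and commutator_T:
      "\<lbrakk>i \<in> {1..n}; j \<in> {1..n}; k \<in> {1..n}; l \<in> {1..n}; u \<in> D; v \<in> D; u \<noteq> v\<rbrakk> \<Longrightarrow>
         T i j u (T k l v w) - T k l v (T i j u w) =
         (c / (u - v)) *s (T k j v (T i l u w) - T k j u (T i l v w))"
    and expansion_T:
      "\<lbrakk>i \<in> {1..n}; j \<in> {1..n}\<rbrakk> \<Longrightarrow>
         ((\<lambda>u. (u / c) ^ (N + 1) *s
               (T i j u w - (if i = j then chi i else 0) *s w
                 - (\<Sum>m<N. (u / c) powi (- int m - 1) *s Tm i j m w)))
          \<longlongrightarrow> Tm i j N w) at_infinity"
    and vac_lower: "\<lbrakk>i \<in> {1..n}; j \<in> {1..n}; i > j; u \<in> D\<rbrakk> \<Longrightarrow> T i j u vac = 0"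
    and vac_diag: "\<lbrakk>i \<in> {1..n}; u \<in> D\<rbrakk> \<Longrightarrow> T i i u vac = lam i u *s vac"

inductive_set creation_words ::
  "nat \<Rightarrow> (nat \<Rightarrow> nat \<Rightarrow> complex \<Rightarrow> 'v \<Rightarrow> 'v) \<Rightarrow> 'v \<Rightarrow> complex set \<Rightarrow> 'v set"
  for n T vac P where
    "vac \<in> creation_words n T vac P"
  | "\<lbrakk>w \<in> creation_words n T vac P; 1 \<le> i; i < j; j \<le> n; x \<in> P\<rbrakk> \<Longrightarrow>
       T i j x w \<in> creation_words n T vac P"

text \<open>Off-shell Bethe vectors are characterised by the properties below: they are polynomials in
  the entries above the diagonal applied to the vacuum, with the given actions of \<open>T 1 n\<close> and of the
  zero modes just below the diagonal.\<close>

locale bethe_vectors = gl_model scale n c chi D T Tm vac lam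
  for scale :: "complex \<Rightarrow> 'v::{topological_ab_group_add,t2_space} \<Rightarrow> 'v" (infixr "*s" 75)
    and n c chi D T Tm vac lam +
  fixes B :: "params \<Rightarrow> 'v"
  assumes B_empty: "B (\<lambda>_. {}) = vac"
    and B_creation: "admissible n c D lam t \<Longrightarrow> B t \<in> span (creation_words n T vac (\<Union>s. t s))"
    and action_T1n:
      "\<lbrakk>admissible n c D lam (add_param 1 n z t); \<forall>s\<in>{1..<n}. z \<notin> t s\<rbrakk> \<Longrightarrow>
         T 1 n z (B t) = mu c lam 1 n z t *s B (add_param 1 n z t)"
    and action_zero_mode:
      "\<lbrakk>admissible n c D lam t; 1 \<le> l; l \<le> n - 1\<rbrakk> \<Longrightarrow>
         Tm (l + 1) l 0 (B t) =
         (\<Sum>(tI, tII) \<in> {p \<in> partitions2 (t l). card (fst p) = 1}.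
            (chi (l + 1) * prod1 (alpha lam l) tI * OmegaL c tII tI (t (l - 1)) (t (l + 1))
              - chi l * OmegaR c tI tII (t (l - 1)) (t (l + 1))) *s B (t(l := tII)))"

end

theory Submission
  imports Defs
begin

text \<open>
  For \<open>l = 1\<close> and \<open>k = n\<close> the recurrence is the action of \<open>T 1 n z\<close>: it adds \<open>z\<close> to every colour, and
  there is nothing to divide. All other cases follow by removing \<open>z\<close> from the first or from the last
  of the colours that contain it, one colour at a time, with the help of the zero modes
  \<open>Tm (l + 1) l 0\<close> and \<open>Tm k (k - 1) 0\<close>.

  A zero mode just below the diagonal removes one parameter of its colour. Applied to the vector with
  \<open>z\<close> in the colours \<open>l, \<dots>, k - 1\<close>, the mode of colour \<open>l\<close> yields the wanted vector, in which \<open>z\<close> has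
  left colour \<open>l\<close>, and vectors in which some \<open>x\<close> of \<open>t l\<close> is missing instead. As long as \<open>z\<close> is still
  present in colour \<open>l + 1\<close>, the wanted vector comes with a coefficient proportional to \<open>chi l\<close> alone,
  because the other summand contains \<open>1 / g z z = 0\<close>; this coefficient does not vanish. The vectors
  without \<open>x\<close> are known by the recurrence already proved. On the other side, the zero mode is moved
  through \<open>T i j z\<close> with \<open>zero_mode_commutator\<close>, the limit of the commutation relation at infinity.
  The commutator terms supply the new row \<open>l + 1\<close> (or the new column \<open>k - 1\<close>), and the action on the
  Bethe vectors extracts one more parameter \<open>x\<close> from the partition.

  It remains to compare coefficients, which is possible for each partition and each \<open>x\<close> separately
  (\<open>coefficients_left\<close>, \<open>coefficients_right\<close>). One of the two summands of the zero mode action cancels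
  completely. For the other one, the difference of two contributions is the coefficient required by
  the next recurrence; after removing common factors this is the partial fraction identity
  \<open>exchange_left\<close> or \<open>exchange_right\<close>.
\<close>

section \<open>Products over sets\<close>

lemma prod2_empty [simp]: "prod2 F {} Y = 1" "prod2 F X {} = 1"
  by (simp_all add: prod2_def)

lemma prod2_singleton [simp]: "prod2 F {x} {y} = F x y"
  by (simp add: prod2_def)

lemma prod2_insert_left:
  "finite X \<Longrightarrow> x \<notin> X \<Longrightarrow> prod2 F (insert x X) Y = prod2 F {x} Y * prod2 F X Y"
  by (simp add: prod2_def)

lemma prod2_insert_right:
  "finite Y \<Longrightarrow> y \<notin> Y \<Longrightarrow> prod2 F X (insert y Y) = prod2 F X {y} * prod2 F X Y"
  by (simp add: prod2_def prod.distrib)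

lemma prod2_remove_left:
  "finite X \<Longrightarrow> x \<in> X \<Longrightarrow> prod2 F X Y = prod2 F {x} Y * prod2 F (X - {x}) Y"
  using prod2_insert_left[of "X - {x}" x F Y] by (simp add: insert_absorb)

lemma prod2_remove_right:
  "finite Y \<Longrightarrow> y \<in> Y \<Longrightarrow> prod2 F X Y = prod2 F X {y} * prod2 F X (Y - {y})"
  using prod2_insert_right[of "Y - {y}" y F X] by (simp add: insert_absorb)

lemma prod2_Un_left:
  "finite X \<Longrightarrow> finite X' \<Longrightarrow> X \<inter> X' = {} \<Longrightarrow> prod2 F (X \<union> X') Y = prod2 F X Y * prod2 F X' Y"
  by (simp add: prod2_def prod.union_disjoint)

lemma prod2_Un_right:
  "finite Y \<Longrightarrow> finite Y' \<Longrightarrow> Y \<inter> Y' = {} \<Longrightarrow> prod2 F X (Y \<union> Y') = prod2 F X Y * prod2 F X Y'"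
  by (simp add: prod2_def prod.union_disjoint prod.distrib)

lemma prod2_quotient:
  "prod2 (\<lambda>x y. F x y / G x y) X Y = prod2 F X Y / prod2 G X Y"
  by (simp add: prod2_def prod_dividef)

lemma prod2_swap: "prod2 (\<lambda>x y. F y x) X Y = prod2 F Y X"
  by (simp add: prod2_def) (rule prod.swap)

lemma prod2_gam: "prod2 (gam c) X Y = prod2 (g c) X Y / prod2 (h c) Y X"
  unfolding gam_def[abs_def] prod2_quotient using prod2_swap[of "h c" X Y] by simp

lemma h_self [simp]: "c \<noteq> 0 \<Longrightarrow> h c x x = 1"
  by (simp add: h_def)

section \<open>Dependence of the coefficients on one parameter\<close>

text \<open>The zero mode of colour \<open>m\<close> acts both on the vector that contains \<open>z\<close> and on the vectors of the
  expansion, which do not contain it and have lost a set \<open>Y\<close> of one neighbouring colour. The next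
  four lemmas compare the coefficients in the two actions. For \<open>m = l\<close> the parameter \<open>z\<close> is also
  present in colour \<open>m + 1\<close> and \<open>Y\<close> is missing from colour \<open>m - 1\<close>; for \<open>m = k - 1\<close> the neighbours
  exchange their roles. In either case the product of the two new factors carrying \<open>z\<close> simplifies,
  by \<open>gam c u v = g c u v / h c v u\<close>, to the inverse of a single \<open>h\<close>, or to a single \<open>g\<close>.\<close>

lemma OmegaR_new_left:
  assumes "finite A" "z \<notin> A" "finite a" "finite Y" "a \<inter> Y = {}" "finite b" "z \<notin> b"
  shows "OmegaR c {x} (insert z A) (a \<union> Y) (insert z b) =
           OmegaR c {x} A a b * (gam c x z * h c z x / prod2 (g c) {x} Y)"
  using assms
  by (simp add: OmegaR_def prod2_insert_left[of A z] prod2_insert_right[of A z]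
      prod2_insert_left[of b z] prod2_Un_right mult_ac)

lemma OmegaL_new_left:
  assumes "finite A" "z \<notin> A" "finite a" "finite Y" "a \<inter> Y = {}" "finite b" "z \<notin> b"
  shows "OmegaL c (insert z A) {x} (a \<union> Y) (insert z b) =
           OmegaL c A {x} a b * (gam c z x * prod2 (h c) {x} Y / g c z x)"
  using assms
  by (simp add: OmegaL_def prod2_insert_left[of A z] prod2_insert_right[of A z]
      prod2_insert_left[of b z] prod2_Un_right mult_ac)

lemma OmegaR_new_right:
  assumes "finite A" "z \<notin> A" "finite b" "finite Y" "b \<inter> Y = {}" "finite a" "z \<notin> a"
  shows "OmegaR c {x} (insert z A) (insert z a) (b \<union> Y) =
           OmegaR c {x} A a b * (gam c x z * prod2 (h c) Y {x} / g c x z)"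
  using assms
  by (simp add: OmegaR_def prod2_insert_left[of A z] prod2_insert_right[of A z]
      prod2_insert_right[of a z] prod2_Un_left mult_ac)

lemma OmegaL_new_right:
  assumes "finite A" "z \<notin> A" "finite b" "finite Y" "b \<inter> Y = {}" "finite a" "z \<notin> a"
  shows "OmegaL c (insert z A) {x} (insert z a) (b \<union> Y) =
           OmegaL c A {x} a b * (gam c z x * h c x z / prod2 (g c) Y {x})"
  using assms
  by (simp add: OmegaL_def prod2_insert_left[of A z] prod2_insert_right[of A z]
      prod2_insert_right[of a z] prod2_Un_left mult_ac)

text \<open>If \<open>z\<close> is also a parameter of the next colour, the factor \<open>1 / g z z\<close>, which stands for
  \<open>(z - z) / c\<close>, kills the coefficient. So only one of the two summands of the zero mode action
  contributes when \<open>z\<close> is removed from the first or the last of several consecutive colours.\<close>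

lemma OmegaL_vanishes: "finite b \<Longrightarrow> OmegaL c A {z} a (insert z b) = 0"
  by (simp add: OmegaL_def prod2_def g_def)

lemma OmegaR_vanishes: "finite a \<Longrightarrow> OmegaR c {z} A (insert z a) b = 0"
  by (simp add: OmegaR_def prod2_def g_def)

text \<open>The identity between rational functions behind both steps of the recurrence. With \<open>p = z - y\<close>,
  \<open>r = x - z\<close> and \<open>r + p = x - y\<close> it is the case \<open>Y = {y}\<close> of \<open>exchange_left\<close>.\<close>

lemma exchange_singleton:
  fixes c p r :: complex
  assumes "c \<noteq> 0" "p \<noteq> 0" "r \<noteq> 0" "r + p \<noteq> 0"
  shows "(c / p) * ((r + p + c) / c) - (r + c) / c * (c / p) * (c / r) / (c / (r + p)) = - (c / r)"
proof -
  have "(c / p) * ((r + p + c) / c) = (r + p + c) * r / (p * r)"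
    using assms by simp
  moreover have "(r + c) / c * (c / p) * (c / r) / (c / (r + p)) = (r + c) * (r + p) / (p * r)"
    using assms by simp
  moreover have "c / r = c * p / (p * r)" using assms by simp
  moreover have "(r + p + c) * r - (r + c) * (r + p) = - (c * p)" by algebra
  ultimately show ?thesis by (metis diff_divide_distrib minus_divide_left)
qed

text \<open>Up to common factors, the two terms on the left are the coefficients with which a zero mode
  removes \<open>x\<close> from the vectors of the expansion and from the vector containing \<open>z\<close>; their
  difference is the coefficient with which \<open>x\<close> joins the extracted parameters. The set \<open>Y\<close> holds the
  parameter already extracted from the adjacent colour, if there is one.\<close>

lemma exchange_left:
  assumes "c \<noteq> 0" "x \<noteq> z" "Y = {} \<or> (\<exists>y. Y = {y} \<and> y \<noteq> x \<and> y \<noteq> z)"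
  shows "prod2 (g c) {z} Y * prod2 (h c) {x} Y
           - h c x z * prod2 (g c) {z} Y * g c x z / prod2 (g c) {x} Y = g c z x"
  using assms(3)
proof
  assume "Y = {}"
  then show ?thesis using assms(1,2) by (simp add: g_def h_def field_simps)
next
  assume "\<exists>y. Y = {y} \<and> y \<noteq> x \<and> y \<noteq> z"
  then obtain y where y: "Y = {y}" "y \<noteq> x" "y \<noteq> z" by blast
  have "- (c / (x - z)) = c / (z - x)" by (metis minus_diff_eq minus_divide_right)
  then show ?thesis
    using exchange_singleton[of c "z - y" "x - z"] assms y by (simp add: g_def h_def)
qed

lemma exchange_right:
  assumes "c \<noteq> 0" "x \<noteq> z" "Y = {} \<or> (\<exists>y. Y = {y} \<and> y \<noteq> x \<and> y \<noteq> z)"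
  shows "prod2 (g c) Y {z} * prod2 (h c) Y {x}
           - h c z x * prod2 (g c) Y {z} * g c z x / prod2 (g c) Y {x} = g c x z"
  using assms(3)
proof
  assume "Y = {}"
  then show ?thesis using assms(1,2) by (simp add: g_def h_def field_simps)
next
  assume "\<exists>y. Y = {y} \<and> y \<noteq> x \<and> y \<noteq> z"
  then obtain y where y: "Y = {y}" "y \<noteq> x" "y \<noteq> z" by blast
  have "- (c / (z - x)) = c / (x - z)" by (metis minus_diff_eq minus_divide_right)
  then show ?thesis
    using exchange_singleton[of c "y - z" "z - x"] assms y by (simp add: g_def h_def)
qed

lemma mu_remove_left:
  assumes "finite (t l)" "x \<in> t l" "1 \<le> l" "l < k - 1"
  shows "mu c lam l k z t = h c x z * mu c lam l k z (t(l := t l - {x}))"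
proof -
  have "prod2 (h c) (t l) {z} = h c x z * prod2 (h c) (t l - {x}) {z}"
    using prod2_remove_left[OF assms(1,2), of "h c" "{z}"] by simp
  moreover have "l - 1 \<noteq> l" "k - 1 \<noteq> l" "k \<noteq> l" using assms by auto
  ultimately show ?thesis by (simp add: mu_def)
qed

lemma mu_remove_right:
  assumes "finite (t (k - 1))" "x \<in> t (k - 1)" "1 \<le> l" "l < k - 1"
  shows "mu c lam l k z t = h c z x * mu c lam l k z (t(k - 1 := t (k - 1) - {x}))"
proof -
  have "prod2 (h c) {z} (t (k-1)) = h c z x * prod2 (h c) {z} (t (k-1) - {x})"
    using prod2_remove_right[OF assms(1,2), of "h c" "{z}"] by simp
  moreover have "l - 1 \<noteq> k - 1" "k - 1 \<noteq> l" "k \<noteq> k - 1" using assms by auto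
  ultimately show ?thesis by (simp add: mu_def)
qed

text \<open>Among the factors of \<open>Xi\<close>, only the one of colour \<open>l - 1\<close> sees the parameters of colour \<open>l\<close>,
  through \<open>h (tII l) (tI (l - 1))\<close>. For \<open>i = l\<close> that factor is absent, and so is
  \<open>tI (l - 1)\<close>.\<close>

lemma Xi_remove_left:
  assumes "finite (tII l)" "x \<in> tII l" "1 \<le> i" "i \<le> l" "l < k - 1"
    and "i = l \<Longrightarrow> tI (l - 1) = {}"
  shows "Xi c lam l k i j z tI tII tIII =
           prod2 (h c) {x} (tI (l - 1)) * Xi c lam l k i j z tI (tII(l := tII l - {x})) tIII"
proof -
  let ?t = "tII(l := tII l - {x})"
  let ?R = "\<lambda>t s. OmegaR c (tI s) (t s) (t (s - 1)) (t (s + 1))"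
  have right: "(\<Prod>s=k..<j. prod1 (alpha lam s) (tIII s)
                     * OmegaL c (tII s) (tIII s) (tII (s - 1)) (tII (s + 1))) =
               (\<Prod>s=k..<j. prod1 (alpha lam s) (tIII s)
                     * OmegaL c (?t s) (tIII s) (?t (s - 1)) (?t (s + 1)))"
    using assms by (intro prod.cong) auto
  have left: "prod (?R tII) {i..<l} = prod2 (h c) {x} (tI (l - 1)) * prod (?R ?t) {i..<l}"
  proof (cases "i = l")
    case True
    then show ?thesis using assms by simp
  next
    case False
    then have eq: "{i..<l} = insert (l - 1) {i..<l - 1}" using assms by auto
    have "l - 1 \<noteq> l" "l - 1 - 1 \<noteq> l" "l - 1 + 1 = l" using assms False by auto
    then have "?R tII (l - 1) = prod2 (h c) {x} (tI (l - 1)) * ?R ?t (l - 1)"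
      by (simp add: OmegaR_def prod2_remove_left[OF assms(1,2), of "h c" "tI (l - 1)"]
          del: One_nat_def)
    moreover have "prod (?R tII) {i..<l - 1} = prod (?R ?t) {i..<l - 1}"
      by (intro prod.cong) auto
    ultimately show ?thesis unfolding eq by simp
  qed
  show ?thesis
    unfolding Xi_def right left by (simp add: mult_ac)
qed

lemma Xi_remove_right:
  assumes "finite (tII (k - 1))" "x \<in> tII (k - 1)" "k \<le> j" "1 \<le> l" "l < k - 1"
    and "j = k \<Longrightarrow> tIII k = {}"
  shows "Xi c lam l k i j z tI tII tIII =
           prod2 (h c) (tIII k) {x} * Xi c lam l k i j z tI (tII(k - 1 := tII (k - 1) - {x})) tIII"
proof -
  let ?t = "tII(k - 1 := tII (k - 1) - {x})"
  let ?L = "\<lambda>t s. prod1 (alpha lam s) (tIII s) * OmegaL c (t s) (tIII s) (t (s - 1)) (t (s + 1))"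
  have left: "(\<Prod>s=i..<l. OmegaR c (tI s) (tII s) (tII (s - 1)) (tII (s + 1))) =
              (\<Prod>s=i..<l. OmegaR c (tI s) (?t s) (?t (s - 1)) (?t (s + 1)))"
    using assms by (intro prod.cong) auto
  have right: "prod (?L tII) {k..<j} = prod2 (h c) (tIII k) {x} * prod (?L ?t) {k..<j}"
  proof (cases "j = k")
    case True
    then show ?thesis using assms by simp
  next
    case False
    then have split: "prod F {k..<j} = F k * prod F {Suc k..<j}" for F :: "nat \<Rightarrow> complex"
      using assms by (simp add: prod.atLeast_Suc_lessThan)
    have "k \<noteq> k - 1" "k + 1 \<noteq> k - 1" using assms by auto
    then have "?L tII k = prod2 (h c) (tIII k) {x} * ?L ?t k"
      by (simp add: OmegaL_def prod2_remove_right[OF assms(1,2), of "h c" "tIII k"]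
          del: One_nat_def)
    moreover have "prod (?L tII) {Suc k..<j} = prod (?L ?t) {Suc k..<j}"
      using assms by (intro prod.cong) auto
    ultimately show ?thesis unfolding split by (simp only: mult_ac)
  qed
  show ?thesis
    unfolding Xi_def right left by (simp add: mult_ac)
qed

text \<open>Extracting \<open>x\<close> from colour \<open>l\<close> moves the outer factor \<open>g\<close> from colour \<open>l - 1\<close> to colour \<open>l\<close> and
  adds one factor \<open>OmegaR\<close>. The equation is multiplied out to avoid a division.\<close>

lemma Xi_extend_left:
  assumes "1 \<le> i" "i \<le> l" "l < k - 1"
  shows "prod2 (g c) {z} (tI (l - 1)) * Xi c lam (l + 1) k i j z (tI(l := {x})) (tII(l := A)) tIII =
           g c z x * OmegaR c {x} A (tII (l - 1)) (tII (l + 1))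
             * Xi c lam l k i j z tI (tII(l := A)) tIII"
proof -
  have eq: "{i..<l + 1} = insert l {i..<l}" using assms by auto
  have "(\<Prod>s=i..<l. OmegaR c ((tI(l := {x})) s) (t s) (t (s - 1)) (t (s + 1))) =
        (\<Prod>s=i..<l. OmegaR c (tI s) (t s) (t (s - 1)) (t (s + 1)))" for t
    by (intro prod.cong) auto
  moreover have "l - 1 \<noteq> l" using assms by auto
  ultimately show ?thesis
    unfolding Xi_def eq using assms by (simp add: mult_ac)
qed

lemma Xi_extend_right:
  assumes "k \<le> j" "1 \<le> l" "l < k - 1"
  shows "prod2 (g c) (tIII k) {z} *
           Xi c lam l (k - 1) i j z tI (tII(k - 1 := A)) (tIII(k - 1 := {x})) =
           g c x z * (alpha lam (k - 1) x * OmegaL c A {x} (tII (k - 1 - 1)) (tII k))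
             * Xi c lam l k i j z tI (tII(k - 1 := A)) tIII"
proof -
  let ?L = "\<lambda>tIII t s. prod1 (alpha lam s) (tIII s) * OmegaL c (t s) (tIII s) (t (s - 1)) (t (s + 1))"
  let ?tII = "tII(k - 1 := A)" and ?tIII = "tIII(k - 1 := {x})"
  have ne: "k - 1 - 1 \<noteq> k - 1" "k \<noteq> k - 1" and Suc: "k - 1 + 1 = k" using assms by auto
  have "prod (?L ?tIII ?tII) {k - 1..<j} = ?L ?tIII ?tII (k - 1) * prod (?L ?tIII ?tII) {k..<j}"
    using assms by (subst prod.atLeast_Suc_lessThan) auto
  also have "?L ?tIII ?tII (k - 1) = alpha lam (k - 1) x * OmegaL c A {x} (tII (k - 1 - 1)) (tII k)"
    using ne unfolding Suc by (simp add: prod1_def)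
  also have "prod (?L ?tIII ?tII) {k..<j} = prod (?L tIII ?tII) {k..<j}"
    using assms by (intro prod.cong) auto
  finally have "prod (?L ?tIII ?tII) {k - 1..<j} =
    alpha lam (k - 1) x * OmegaL c A {x} (tII (k - 1 - 1)) (tII k) * prod (?L tIII ?tII) {k..<j}" .
  moreover have "?tIII k = tIII k" "?tIII (k - 1) = {x}" using ne by simp_all
  ultimately show ?thesis
    unfolding Xi_def by (simp only: mult_ac prod2_singleton)
qed

section \<open>Partitions with prescribed cardinalities\<close>

text \<open>The cardinalities enter as functions, because a step of the recurrence changes them at a single
  colour from \<open>0\<close> to \<open>1\<close>.\<close>

definition sized_partitions ::
  "nat \<Rightarrow> (nat \<Rightarrow> nat) \<Rightarrow> (nat \<Rightarrow> nat) \<Rightarrow> params \<Rightarrow> (params \<times> params \<times> params) set" where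
  "sized_partitions n a b t =
     {(tI, tII, tIII).
        (\<forall>s. tI s \<union> tII s \<union> tIII s = t s \<and>
             tI s \<inter> tII s = {} \<and> tI s \<inter> tIII s = {} \<and> tII s \<inter> tIII s = {}) \<and>
        (\<forall>s\<in>{1..<n}. card (tI s) = a s \<and> card (tIII s) = b s)}"

lemma partitions3_eq:
  "partitions3 n l k i j t =
     sized_partitions n (\<lambda>s. if s < l then Theta (int s - int i) else 0)
       (\<lambda>s. if s \<le> k - 1 then 0 else Theta (int j - int s - 1)) t"
  by (simp add: partitions3_def sized_partitions_def)

lemma sized_partitions_fixed:
  assumes "(tI, tII, tIII) \<in> sized_partitions n a b t" "m \<in> {1..<n}" "a m = 0" "b m = 0"
    and "finite (t m)"
  shows "tI m = {}" "tIII m = {}" "tII m = t m"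
proof -
  have *: "tI m \<union> tII m \<union> tIII m = t m" "card (tI m) = 0" "card (tIII m) = 0"
    using assms by (auto simp: sized_partitions_def)
  then have "finite (tI m)" "finite (tIII m)" using assms(5) by (metis finite_Un)+
  then show "tI m = {}" "tIII m = {}" using * by auto
  then show "tII m = t m" using * by auto
qed

text \<open>A colour that is not divided occurs only as \<open>tII m\<close>, and its set can be replaced freely.\<close>

lemma sum_sized_partitions_update:
  assumes m: "m \<in> {1..<n}" "a m = 0" "b m = 0" and fin: "finite (t m)" "finite X"
  shows "(\<Sum>(tI, tII, tIII) \<in> sized_partitions n a b (t(m := X)). F tI tII tIII) =
         (\<Sum>(tI, tII, tIII) \<in> sized_partitions n a b t. F tI (tII(m := X)) tIII)"
proof -
  have fixed: "tI m = {} \<and> tIII m = {} \<and> tII m = t m"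
    if "(tI, tII, tIII) \<in> sized_partitions n a b t" "finite (t m)" for t tI tII tIII
    using sized_partitions_fixed[where t=t and m=m] that m by blast
  have move: "(tI, tII(m := X), tIII) \<in> sized_partitions n a b (t(m := X))"
    if "(tI, tII, tIII) \<in> sized_partitions n a b t" "finite (t m)" for t tI tII tIII X
    using that(1) fixed[OF that] by (auto simp: sized_partitions_def)
  show ?thesis
  proof (rule sum.reindex_bij_witness[where
        i = "\<lambda>(tI, tII, tIII). (tI, tII(m := X), tIII)" and
        j = "\<lambda>(tI, tII, tIII). (tI, tII(m := t m), tIII)"])
    fix p assume p: "p \<in> sized_partitions n a b (t(m := X))"
    obtain tI tII tIII where [simp]: "p = (tI, tII, tIII)" by (cases p)
    have "tII m = X" using fixed[of tI tII tIII "t(m := X)"] p fin by auto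
    then show "(case case p of (tI, tII, tIII) \<Rightarrow> (tI, tII(m := t m), tIII) of
            (tI, tII, tIII) \<Rightarrow> (tI, tII(m := X), tIII)) = p"
      "(case case p of (tI, tII, tIII) \<Rightarrow> (tI, tII(m := t m), tIII) of
            (tI, tII, tIII) \<Rightarrow> F tI (tII(m := X)) tIII) = (case p of (tI, tII, tIII) \<Rightarrow> F tI tII tIII)"
      by (auto simp: fun_upd_idem)
    show "(case p of (tI, tII, tIII) \<Rightarrow> (tI, tII(m := t m), tIII)) \<in> sized_partitions n a b t"
      using move[of tI tII tIII "t(m := X)" "t m"] p fin by simp
  next
    fix p assume p: "p \<in> sized_partitions n a b t"
    obtain tI tII tIII where [simp]: "p = (tI, tII, tIII)" by (cases p)
    have "tII m = t m" using fixed[of tI tII tIII "t"] p fin by auto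
    then show "(case case p of (tI, tII, tIII) \<Rightarrow> (tI, tII(m := X), tIII) of
            (tI, tII, tIII) \<Rightarrow> (tI, tII(m := t m), tIII)) = p"
      by (auto simp: fun_upd_idem)
    show "(case p of (tI, tII, tIII) \<Rightarrow> (tI, tII(m := X), tIII))
            \<in> sized_partitions n a b (t(m := X))"
      using move[of tI tII tIII t X] p fin by simp
  qed
qed

text \<open>Choosing a partition that extracts one element of colour \<open>m\<close> is choosing this element and a
  partition that leaves colour \<open>m\<close> undivided.\<close>

lemma sum_sized_partitions_extend_left:
  assumes m: "m \<in> {1..<n}" "a m = 0" "b m = 0" and fin: "finite (t m)"
  shows "(\<Sum>(tI, tII, tIII) \<in> sized_partitions n (a(m := 1)) b t. F tI tII tIII) =
         (\<Sum>x\<in>t m. \<Sum>(tI, tII, tIII) \<in> sized_partitions n a b t.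
            F (tI(m := {x})) (tII(m := t m - {x})) tIII)"
proof -
  have fixed: "tI m = {} \<and> tIII m = {} \<and> tII m = t m"
    if "(tI, tII, tIII) \<in> sized_partitions n a b t" for tI tII tIII
    using sized_partitions_fixed[where t=t and m=m] that m fin by blast
  have sel: "\<exists>x. x \<in> t m \<and> tI m = {x} \<and> tII m = t m - {x} \<and> tIII m = {}"
    if "(tI, tII, tIII) \<in> sized_partitions n (a(m := 1)) b t" for tI tII tIII
  proof -
    have *: "tI m \<union> tII m \<union> tIII m = t m" "tI m \<inter> tII m = {}" "card (tI m) = 1" "card (tIII m) = 0"
      using that m by (auto simp: sized_partitions_def)
    then have "tIII m = {}" using fin by (metis card_0_eq finite_Un)
    moreover obtain x where "tI m = {x}" using *(3) by (auto simp: card_1_singleton_iff)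
    ultimately show ?thesis using * by auto
  qed
  have "(\<Sum>(tI, tII, tIII) \<in> sized_partitions n (a(m := 1)) b t. F tI tII tIII) =
        (\<Sum>(x, tI, tII, tIII) \<in> t m \<times> sized_partitions n a b t.
            F (tI(m := {x})) (tII(m := t m - {x})) tIII)"
  proof (rule sum.reindex_bij_witness[where
        i = "\<lambda>(x, tI, tII, tIII). (tI(m := {x}), tII(m := t m - {x}), tIII)" and
        j = "\<lambda>(tI, tII, tIII). (the_elem (tI m), tI(m := {}), tII(m := t m), tIII)"])
    fix p assume p: "p \<in> sized_partitions n (a(m := 1)) b t"
    obtain tI tII tIII where pp [simp]: "p = (tI, tII, tIII)" by (cases p)
    obtain x where x: "x \<in> t m" "tI m = {x}" "tII m = t m - {x}" "tIII m = {}"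
      using sel p[unfolded pp] by blast
    have [simp]: "tI(m := {x}) = tI" "tII(m := t m - {x}) = tII" using x by (simp_all add: fun_upd_idem)
    show "(case case p of (tI, tII, tIII) \<Rightarrow> (the_elem (tI m), tI(m := {}), tII(m := t m), tIII) of
           (x, tI, tII, tIII) \<Rightarrow> (tI(m := {x}), tII(m := t m - {x}), tIII)) = p"
      "(case case p of (tI, tII, tIII) \<Rightarrow> (the_elem (tI m), tI(m := {}), tII(m := t m), tIII) of
           (x, tI, tII, tIII) \<Rightarrow> F (tI(m := {x})) (tII(m := t m - {x})) tIII) =
       (case p of (tI, tII, tIII) \<Rightarrow> F tI tII tIII)"
      using x by (simp_all add: fun_upd_idem)
    show "(case p of (tI, tII, tIII) \<Rightarrow> (the_elem (tI m), tI(m := {}), tII(m := t m), tIII))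
            \<in> t m \<times> sized_partitions n a b t"
      using p x m by (auto simp: sized_partitions_def)
  next
    fix q assume q: "q \<in> t m \<times> sized_partitions n a b t"
    obtain x tI tII tIII where qq [simp]: "q = (x, tI, tII, tIII)" by (cases q)
    have x: "tI m = {}" "tIII m = {}" "tII m = t m" "x \<in> t m"
      using fixed q[unfolded qq] by blast+
    have [simp]: "tI(m := {}) = tI" "tII(m := t m) = tII" using x by (simp_all add: fun_upd_idem)
    show "(case case q of (x, tI, tII, tIII) \<Rightarrow> (tI(m := {x}), tII(m := t m - {x}), tIII) of
           (tI, tII, tIII) \<Rightarrow> (the_elem (tI m), tI(m := {}), tII(m := t m), tIII)) = q"
      by simp
    show "(case q of (x, tI, tII, tIII) \<Rightarrow> (tI(m := {x}), tII(m := t m - {x}), tIII))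
            \<in> sized_partitions n (a(m := 1)) b t"
      using q x by (auto simp: sized_partitions_def)
  qed
  then show ?thesis by (simp add: sum.cartesian_product)
qed

lemma sum_sized_partitions_swap:
  "(\<Sum>(tI, tII, tIII) \<in> sized_partitions n a b t. F tI tII tIII) =
   (\<Sum>(tI, tII, tIII) \<in> sized_partitions n b a t. F tIII tII tI)"
  by (rule sum.reindex_bij_witness[where
        i = "\<lambda>(tI, tII, tIII). (tIII, tII, tI)" and j = "\<lambda>(tI, tII, tIII). (tIII, tII, tI)"])
     (auto simp: sized_partitions_def)

lemma sum_sized_partitions_extend_right:
  assumes "m \<in> {1..<n}" "a m = 0" "b m = 0" "finite (t m)"
  shows "(\<Sum>(tI, tII, tIII) \<in> sized_partitions n a (b(m := 1)) t. F tI tII tIII) =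
         (\<Sum>x\<in>t m. \<Sum>(tI, tII, tIII) \<in> sized_partitions n a b t.
            F tI (tII(m := t m - {x})) (tIII(m := {x})))"
  using assms
  by (subst sum_sized_partitions_swap, subst sum_sized_partitions_extend_left)
     (simp_all add: sum_sized_partitions_swap[of _ n b a])

lemma sum_partitions2_singleton:
  "(\<Sum>(X1, X2) \<in> {p \<in> partitions2 X. card (fst p) = 1}. F X1 X2) = (\<Sum>x\<in>X. F {x} (X - {x}))"
  by (rule sum.reindex_bij_witness[where
        i = "\<lambda>x. ({x}, X - {x})" and j = "\<lambda>(X1, X2). the_elem X1"])
     (auto simp: partitions2_def card_1_singleton_iff)

section \<open>Generic parameters\<close>

text \<open>For \<open>u = v\<close> this uses \<open>h u u = 1\<close>, so the two points may be chosen independently.\<close>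

lemma generic_h_nonzero:
  assumes "generic_params n c D lam z t" "c \<noteq> 0"
    and "u \<in> insert z (\<Union>s. t s)" "v \<in> insert z (\<Union>s. t s)"
  shows "h c u v \<noteq> 0"
proof -
  have same: "\<forall>s. \<forall>x\<in>t s. \<forall>y\<in>t s. x - y \<noteq> c"
    and other: "\<forall>r s. r \<noteq> s \<longrightarrow> (\<forall>x\<in>t r. \<forall>y\<in>t s. x \<noteq> y \<and> x - y \<noteq> c)"
    and new: "\<forall>s. \<forall>x\<in>t s. x \<noteq> z \<and> x - z \<noteq> c \<and> z - x \<noteq> c"
    using assms(1) unfolding generic_params_def admissible_def by simp_all
  have all: "x - y \<noteq> c" if "x \<in> t r" "y \<in> t s" for x y r s
    using that same other by (cases "r = s") blast+
  have "v - u \<noteq> c"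
  proof (cases "u = z \<or> v = z")
    case True
    then show ?thesis using assms(2-4) new by (metis UN_E diff_self insertE)
  next
    case False
    then show ?thesis using assms(3,4) all by blast
  qed
  moreover have "v - u = c" if "u - v + c = 0" using that by algebra
  ultimately have "u - v + c \<noteq> 0" by blast
  then show ?thesis using assms(2) by (simp add: h_def)
qed

lemma g_nonzero: "c \<noteq> 0 \<Longrightarrow> u \<noteq> v \<Longrightarrow> g c u v \<noteq> 0"
  by (simp add: g_def)

lemma generic_finite: "generic_params n c D lam z t \<Longrightarrow> finite (t s)"
  by (simp add: generic_params_def admissible_def)

lemma generic_fresh: "generic_params n c D lam z t \<Longrightarrow> z \<notin> t s"
  by (auto simp: generic_params_def)

lemma generic_disjoint: "generic_params n c D lam z t \<Longrightarrow> r \<noteq> s \<Longrightarrow> t r \<inter> t s = {}"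
  by (auto simp: generic_params_def)

lemma generic_outside: "generic_params n c D lam z t \<Longrightarrow> s \<notin> {1..<n} \<Longrightarrow> t s = {}"
  by (simp add: generic_params_def admissible_def)

lemma generic_subset:
  assumes "generic_params n c D lam z t" "\<And>s. t' s \<subseteq> t s"
  shows "generic_params n c D lam z t'"
proof -
  have fin: "\<forall>s. finite (t s)" and D: "\<forall>s. \<forall>x\<in>t s. x \<in> D"
    and lam: "\<forall>s. \<forall>x\<in>t s. \<forall>i\<in>{1..n}. lam i x \<noteq> 0"
    and same: "\<forall>s. \<forall>x\<in>t s. \<forall>y\<in>t s. x - y \<noteq> c"
    and other: "\<forall>r s. r \<noteq> s \<longrightarrow> (\<forall>x\<in>t r. \<forall>y\<in>t s. x \<noteq> y \<and> x - y \<noteq> c)"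
    and new: "\<forall>s. \<forall>x\<in>t s. x \<noteq> z \<and> x - z \<noteq> c \<and> z - x \<noteq> c"
    and z: "z \<in> D" "\<forall>i\<in>{1..n}. lam i z \<noteq> 0"
    using assms(1) unfolding generic_params_def admissible_def by simp_all
  have "\<forall>s. s \<notin> {1..<n} \<longrightarrow> t' s = {}"
    using generic_outside[OF assms(1)] assms(2) by (metis subset_empty)
  moreover have "\<forall>s. finite (t' s)" using fin assms(2) finite_subset by metis
  moreover have "\<forall>s. \<forall>x\<in>t' s. \<forall>y\<in>t' s. x - y \<noteq> c" using same assms(2) by (meson subsetD)
  moreover have "\<forall>s. \<forall>x\<in>t' s. x \<in> D \<and> (\<forall>i\<in>{1..n}. lam i x \<noteq> 0)"
    using D lam assms(2) by (meson subsetD)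
  moreover have "\<forall>r s. r \<noteq> s \<longrightarrow> (\<forall>x\<in>t' r. \<forall>y\<in>t' s. x \<noteq> y \<and> x - y \<noteq> c)"
    using other assms(2) by (meson subsetD)
  moreover have "\<forall>s. \<forall>x\<in>t' s. x \<noteq> z \<and> x - z \<noteq> c \<and> z - x \<noteq> c"
    using new assms(2) by (meson subsetD)
  ultimately show ?thesis
    unfolding generic_params_def admissible_def using z by (intro conjI)
qed

lemma generic_admissible: "generic_params n c D lam z t \<Longrightarrow> admissible n c D lam t"
  by (simp add: generic_params_def)

lemma admissible_add_param:
  assumes "generic_params n c D lam z t" "c \<noteq> 0" "1 \<le> l" "k \<le> n"
  shows "admissible n c D lam (add_param l k z t)"
proof -
  have fin: "\<forall>s. finite (t s)" and D: "\<forall>s. \<forall>x\<in>t s. x \<in> D"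
    and lam: "\<forall>s. \<forall>x\<in>t s. \<forall>i\<in>{1..n}. lam i x \<noteq> 0"
    and same: "\<forall>s. \<forall>x\<in>t s. \<forall>y\<in>t s. x - y \<noteq> c"
    and other: "\<forall>r s. r \<noteq> s \<longrightarrow> (\<forall>x\<in>t r. \<forall>y\<in>t s. x \<noteq> y \<and> x - y \<noteq> c)"
    and new: "\<forall>s. \<forall>x\<in>t s. x \<noteq> z \<and> x - z \<noteq> c \<and> z - x \<noteq> c"
    and z: "z \<in> D" "\<forall>i\<in>{1..n}. lam i z \<noteq> 0"
    using assms(1) unfolding generic_params_def admissible_def by simp_all
  have sub: "add_param l k z t s \<subseteq> insert z (t s)" for s
    by (auto simp: add_param_def)
  have "\<forall>s. s \<notin> {1..<n} \<longrightarrow> add_param l k z t s = {}"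
    using generic_outside[OF assms(1)] assms(3,4) by (auto simp: add_param_def)
  moreover have "\<forall>s. finite (add_param l k z t s)" using fin by (simp add: add_param_def)
  moreover have "\<forall>x\<in>insert z (t s). x \<in> D \<and> (\<forall>i\<in>{1..n}. lam i x \<noteq> 0)" for s
    using D lam z by (metis insertE)
  then have "\<forall>s. \<forall>x\<in>add_param l k z t s. x \<in> D \<and> (\<forall>i\<in>{1..n}. lam i x \<noteq> 0)"
    using sub by (meson subsetD)
  moreover have "\<forall>x\<in>insert z (t s). \<forall>y\<in>insert z (t s). x - y \<noteq> c" for s
    using same new assms(2) by (metis insertE diff_self)
  then have "\<forall>s. \<forall>x\<in>add_param l k z t s. \<forall>y\<in>add_param l k z t s. x - y \<noteq> c"
    using sub by (meson subsetD)
  ultimately show ?thesis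
    unfolding admissible_def by (intro conjI)
qed

lemma generic_prod_g_nonzero:
  assumes "generic_params n c D lam z t" "c \<noteq> 0"
  shows "prod2 (g c) {z} (t s) \<noteq> 0" "prod2 (g c) (t s) {z} \<noteq> 0"
  using generic_finite[OF assms(1), of s] generic_fresh[OF assms(1), of s] assms(2)
  by (auto simp: prod2_def g_def)

lemma generic_prod_h_nonzero:
  assumes "generic_params n c D lam z t" "c \<noteq> 0"
  shows "prod2 (h c) {z} (t s) \<noteq> 0" "prod2 (h c) (t s) {z} \<noteq> 0"
proof -
  have "h c z x \<noteq> 0" "h c x z \<noteq> 0" if "x \<in> t s" for x
    using that generic_h_nonzero[OF assms, of z x] generic_h_nonzero[OF assms, of x z] by auto
  then show "prod2 (h c) {z} (t s) \<noteq> 0" "prod2 (h c) (t s) {z} \<noteq> 0"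
    using generic_finite[OF assms(1), of s] by (auto simp: prod2_def)
qed

lemma mu_nonzero:
  assumes "generic_params n c D lam z t" "c \<noteq> 0" "1 \<le> k" "k \<le> n"
  shows "mu c lam l k z t \<noteq> 0"
proof -
  have "lam k z \<noteq> 0" using assms by (simp add: generic_params_def)
  then show ?thesis
    using generic_prod_g_nonzero[OF assms(1,2)] generic_prod_h_nonzero[OF assms(1,2)]
    by (simp add: mu_def)
qed

text \<open>The coefficient with which a zero mode removes \<open>z\<close> turns the normalization of one recurrence into
  that of the next one.\<close>

lemma OmegaR_mu:
  assumes "generic_params n c D lam z t" "c \<noteq> 0"
  shows "mu c lam l k z t * OmegaR c {z} (t l) (t (l - 1)) (insert z (t (l + 1))) =
           mu c lam (l + 1) k z t"
proof -
  have "prod2 (h c) (insert z (t (l + 1))) {z} = prod2 (h c) (t (l + 1)) {z}"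
    using prod2_insert_left[OF generic_finite generic_fresh, OF assms(1,1)] assms(2) by simp
  then show ?thesis
    using generic_prod_g_nonzero[OF assms] generic_prod_h_nonzero[OF assms]
    by (simp add: mu_def OmegaR_def prod2_gam)
qed

lemma OmegaL_mu:
  assumes "generic_params n c D lam z t" "c \<noteq> 0" "2 \<le> k" "k \<le> n"
  shows "mu c lam l k z t *
           (alpha lam (k - 1) z * OmegaL c (t (k - 1)) {z} (insert z (t (k - 1 - 1))) (t k)) =
           mu c lam l (k - 1) z t"
proof -
  have "prod2 (h c) {z} (insert z (t (k - 1 - 1))) = prod2 (h c) {z} (t (k - 1 - 1))"
    using prod2_insert_right[OF generic_finite generic_fresh, OF assms(1,1)] assms(2) by simp
  moreover have "lam k z \<noteq> 0" using assms by (simp add: generic_params_def)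
  moreover have "alpha lam (k - 1) z = lam (k - 1) z / lam k z"
    using assms by (simp add: alpha_def)
  ultimately show ?thesis
    using generic_prod_g_nonzero[OF assms(1,2)] generic_prod_h_nonzero[OF assms(1,2)]
    by (simp add: mu_def OmegaL_def prod2_gam)
qed

lemma partitions3_cover:
  assumes "(tI, tII, tIII) \<in> partitions3 n l k i j t"
  shows "tI s \<union> tII s \<union> tIII s = t s" "tI s \<inter> tII s = {}" "tII s \<inter> tIII s = {}"
  using assms by (auto simp: partitions3_def)

lemma partitions3_I_empty:
  assumes "(tI, tII, tIII) \<in> partitions3 n l k i j t" "generic_params n c D lam z t"
    and "l \<le> s \<or> s < i"
  shows "tI s = {}"
proof (cases "s \<in> {1..<n}")
  case True
  then have "card (tI s) = 0" using assms by (auto simp: partitions3_def Theta_def)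
  then show ?thesis
    using partitions3_cover(1)[OF assms(1), of s] generic_finite[OF assms(2), of s]
    by (metis card_0_eq finite_Un)
next
  case False
  then show ?thesis
    using partitions3_cover(1)[OF assms(1), of s] generic_outside[OF assms(2)] by auto
qed

lemma partitions3_III_empty:
  assumes "(tI, tII, tIII) \<in> partitions3 n l k i j t" "generic_params n c D lam z t"
    and "s \<le> k - 1 \<or> j \<le> s"
  shows "tIII s = {}"
proof (cases "s \<in> {1..<n}")
  case True
  then have "card (tIII s) = 0" using assms by (auto simp: partitions3_def Theta_def)
  then show ?thesis
    using partitions3_cover(1)[OF assms(1), of s] generic_finite[OF assms(2), of s]
    by (metis card_0_eq finite_Un)
next
  case False
  then show ?thesis
    using partitions3_cover(1)[OF assms(1), of s] generic_outside[OF assms(2)] by auto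
qed

lemma partitions3_I_cases:
  assumes "(tI, tII, tIII) \<in> partitions3 n l k i j t" "generic_params n c D lam z t"
  shows "tI s = {} \<or> (\<exists>y. tI s = {y})"
proof (cases "(l \<le> s \<or> s < i) \<or> s \<notin> {1..<n}")
  case True
  then show ?thesis
    using partitions3_I_empty[OF assms] partitions3_cover(1)[OF assms(1), of s]
      generic_outside[OF assms(2)] by auto
next
  case False
  then have "card (tI s) = 1" using assms(1) by (auto simp: partitions3_def Theta_def)
  then show ?thesis by (auto simp: card_1_singleton_iff)
qed

lemma partitions3_III_cases:
  assumes "(tI, tII, tIII) \<in> partitions3 n l k i j t" "generic_params n c D lam z t"
  shows "tIII s = {} \<or> (\<exists>y. tIII s = {y})"
proof (cases "(s \<le> k - 1 \<or> j \<le> s) \<or> s \<notin> {1..<n}")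
  case True
  then show ?thesis
    using partitions3_III_empty[OF assms] partitions3_cover(1)[OF assms(1), of s]
      generic_outside[OF assms(2)] by auto
next
  case False
  then have "card (tIII s) = 1" using assms(1) by (auto simp: partitions3_def Theta_def)
  then show ?thesis by (auto simp: card_1_singleton_iff)
qed

section \<open>Comparison of coefficients\<close>

text \<open>The coefficientwise form of the step from \<open>(l, k)\<close> to \<open>(l + 1, k)\<close>, for the extraction of
  \<open>x\<close> from colour \<open>l\<close>. In the first equation, the part of the zero mode action proportional to
  \<open>chi (l + 1)\<close>, the expansion and the vector with \<open>z\<close> give the same contribution, so nothing
  remains. In the second one, the part proportional to \<open>chi l\<close>, the difference of the
  contributions is the new coefficient. The factor \<open>h x z\<close> is the
  ratio of the normalizations \<open>mu\<close> with and without \<open>x\<close>.\<close>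

lemma coefficients_left:
  assumes gen: "generic_params n c D lam z t" and c: "c \<noteq> 0"
    and p: "(tI, tII, tIII) \<in> partitions3 n l k i j t"
    and ineqs: "1 \<le> i" "i \<le> l" "l < k - 1" and x: "x \<in> t l"
  defines "A \<equiv> t l - {x}"
  shows "Xi c lam l k i j z tI tII tIII * OmegaL c A {x} (tII (l - 1)) (tII (l + 1)) =
           OmegaL c (insert z A) {x} (t (l - 1)) (insert z (t (l + 1))) * h c x z
             * Xi c lam l k i j z tI (tII(l := A)) tIII" (is ?L)
    and "Xi c lam l k i j z tI tII tIII * OmegaR c {x} A (tII (l - 1)) (tII (l + 1))
           - OmegaR c {x} (insert z A) (t (l - 1)) (insert z (t (l + 1))) * h c x z
             * Xi c lam l k i j z tI (tII(l := A)) tIII =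
           Xi c lam (l + 1) k i j z (tI(l := {x})) (tII(l := A)) tIII" (is ?R)
proof -
  note fin = generic_finite[OF gen] and fresh = generic_fresh[OF gen]
    and cover = partitions3_cover[OF p]
  let ?Y = "tI (l - 1)"
  let ?Xi = "Xi c lam l k i j z tI tII tIII"
  let ?Xi1 = "Xi c lam l k i j z tI (tII(l := A)) tIII"
  let ?Xi2 = "Xi c lam (l + 1) k i j z (tI(l := {x})) (tII(l := A)) tIII"
  let ?aR = "OmegaR c {x} A (tII (l - 1)) (tII (l + 1))"
  let ?aL = "OmegaL c A {x} (tII (l - 1)) (tII (l + 1))"
  have tIII: "tIII (l - 1) = {}" "tIII l = {}" "tIII (l + 1) = {}"
    using ineqs by (auto intro!: partitions3_III_empty[OF p gen])
  have tI: "tI l = {}" "tI (l + 1) = {}"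
    using ineqs by (auto intro!: partitions3_I_empty[OF p gen])
  have tII: "tII l = t l" "t (l + 1) = tII (l + 1)" "t (l - 1) = tII (l - 1) \<union> ?Y"
    using tI tIII cover(1)[of l] cover(1)[of "l + 1"] cover(1)[of "l - 1"] by auto
  have Y0: "?Y = {}" if "i = l"
    using ineqs that by (intro partitions3_I_empty[OF p gen]) auto
  have Ysub: "?Y \<subseteq> t (l - 1)" using cover(1)[of "l - 1"] by auto
  have "t l \<inter> t (l - 1) = {}" using ineqs by (intro generic_disjoint[OF gen]) auto
  then have Y: "?Y = {} \<or> (\<exists>y. ?Y = {y} \<and> y \<noteq> x \<and> y \<noteq> z)"
    using partitions3_I_cases[OF p gen, of "l - 1"] Ysub x fresh[of "l - 1"] by blast
  have xz: "x \<noteq> z" using fresh x by blast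
  have A: "finite A" "z \<notin> A" using fin fresh by (auto simp: A_def)
  have h: "h c x z \<noteq> 0" "h c z x \<noteq> 0"
    using x generic_h_nonzero[OF gen c, of z x] generic_h_nonzero[OF gen c, of x z] by auto
  have finII: "finite (tII (l - 1))" "finite ?Y" "finite (tII (l + 1))"
    using fin[of "l - 1"] fin[of "l + 1"] tII by auto
  have dis: "tII (l - 1) \<inter> ?Y = {}" "z \<notin> tII (l + 1)"
    using cover(2)[of "l - 1"] fresh[of "l + 1"] tII(2) by auto
  have gY: "prod2 (g c) {z} ?Y \<noteq> 0"
    using Y g_nonzero[OF c] by auto
  have Xi: "?Xi = prod2 (h c) {x} ?Y * ?Xi1"
    unfolding A_def tII(1)[symmetric]
    by (rule Xi_remove_left) (use x fin tII ineqs Y0 in auto)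
  have Xi2: "prod2 (g c) {z} ?Y * ?Xi2 = g c z x * ?aR * ?Xi1"
    by (rule Xi_extend_left) (use ineqs in auto)
  have bL: "OmegaL c (insert z A) {x} (t (l - 1)) (insert z (t (l + 1))) =
            ?aL * (gam c z x * prod2 (h c) {x} ?Y / g c z x)"
    unfolding tII(2,3) by (rule OmegaL_new_left) (use A finII dis in auto)
  have bR: "OmegaR c {x} (insert z A) (t (l - 1)) (insert z (t (l + 1))) =
            ?aR * (gam c x z * h c z x / prod2 (g c) {x} ?Y)"
    unfolding tII(2,3) by (rule OmegaR_new_left) (use A finII dis in auto)
  show ?L
    unfolding bL Xi gam_def using g_nonzero[OF c xz[symmetric]] h by simp
  \<comment> \<open>Both sides are compared after multiplication by this factor, which is not zero.\<close>
  have "prod2 (g c) {z} ?Y * (?Xi * ?aR - ?aR * (gam c x z * h c z x / prod2 (g c) {x} ?Y) * h c x z * ?Xi1)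
     = ?aR * ?Xi1 * (prod2 (g c) {z} ?Y * prod2 (h c) {x} ?Y
           - h c x z * prod2 (g c) {z} ?Y * g c x z / prod2 (g c) {x} ?Y)"
    unfolding Xi gam_def using h by (simp add: algebra_simps)
  also have "\<dots> = prod2 (g c) {z} ?Y * ?Xi2"
    unfolding exchange_left[OF c xz Y] Xi2 by simp
  finally show ?R
    unfolding bR using gY by (simp only: mult_cancel_left) simp
qed

text \<open>The analogue for the step from \<open>(l, k)\<close> to \<open>(l, k - 1)\<close>: here the part proportional to
  \<open>chi (k - 1)\<close> cancels and the part proportional to \<open>chi k\<close> survives.\<close>

lemma coefficients_right:
  assumes gen: "generic_params n c D lam z t" and c: "c \<noteq> 0"
    and p: "(tI, tII, tIII) \<in> partitions3 n l k i j t"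
    and ineqs: "1 \<le> i" "i \<le> l" "l < k - 1" "k \<le> j" and x: "x \<in> t (k - 1)"
  defines "A \<equiv> t (k - 1) - {x}"
  shows "Xi c lam l k i j z tI tII tIII * OmegaR c {x} A (tII (k - 1 - 1)) (tII k) =
           OmegaR c {x} (insert z A) (insert z (t (k - 1 - 1))) (t k) * h c z x
             * Xi c lam l k i j z tI (tII(k - 1 := A)) tIII" (is ?R)
    and "Xi c lam l k i j z tI tII tIII
             * (alpha lam (k - 1) x * OmegaL c A {x} (tII (k - 1 - 1)) (tII k))
           - alpha lam (k - 1) x * OmegaL c (insert z A) {x} (insert z (t (k - 1 - 1))) (t k)
             * h c z x * Xi c lam l k i j z tI (tII(k - 1 := A)) tIII =
           Xi c lam l (k - 1) i j z tI (tII(k - 1 := A)) (tIII(k - 1 := {x}))" (is ?L)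
proof -
  note fin = generic_finite[OF gen] and fresh = generic_fresh[OF gen]
    and cover = partitions3_cover[OF p]
  let ?Y = "tIII k" and ?m = "k - 1"
  let ?Xi = "Xi c lam l k i j z tI tII tIII"
  let ?Xi1 = "Xi c lam l k i j z tI (tII(?m := A)) tIII"
  let ?Xi2 = "Xi c lam l ?m i j z tI (tII(?m := A)) (tIII(?m := {x}))"
  let ?aR = "OmegaR c {x} A (tII (?m - 1)) (tII k)"
  let ?aL = "OmegaL c A {x} (tII (?m - 1)) (tII k)"
  have tIII: "tIII (?m - 1) = {}" "tIII ?m = {}"
    using ineqs by (auto intro!: partitions3_III_empty[OF p gen])
  have tI: "tI ?m = {}" "tI (?m - 1) = {}" "tI k = {}"
    using ineqs by (auto intro!: partitions3_I_empty[OF p gen])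
  have tII: "tII ?m = t ?m" "t (?m - 1) = tII (?m - 1)" "t k = tII k \<union> ?Y"
    using tI tIII cover(1)[of ?m] cover(1)[of "?m - 1"] cover(1)[of k] by auto
  have Y0: "?Y = {}" if "j = k"
    using ineqs that by (intro partitions3_III_empty[OF p gen]) auto
  have Ysub: "?Y \<subseteq> t k" using cover(1)[of k] by auto
  have "t ?m \<inter> t k = {}" using ineqs by (intro generic_disjoint[OF gen]) auto
  then have Y: "?Y = {} \<or> (\<exists>y. ?Y = {y} \<and> y \<noteq> x \<and> y \<noteq> z)"
    using partitions3_III_cases[OF p gen, of k] Ysub x fresh[of k] by blast
  have xz: "x \<noteq> z" using fresh x by blast
  have A: "finite A" "z \<notin> A" using fin fresh by (auto simp: A_def)
  have h: "h c x z \<noteq> 0" "h c z x \<noteq> 0"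
    using x generic_h_nonzero[OF gen c, of z x] generic_h_nonzero[OF gen c, of x z] by auto
  have finII: "finite (tII (?m - 1))" "finite ?Y" "finite (tII k)"
    using fin[of "?m - 1"] fin[of k] tII by auto
  have dis: "tII k \<inter> ?Y = {}" "z \<notin> tII (?m - 1)"
    using cover(3)[of k] fresh[of "?m - 1"] tII(2) by auto
  have gY: "prod2 (g c) ?Y {z} \<noteq> 0"
    using Y g_nonzero[OF c] by auto
  have Xi: "?Xi = prod2 (h c) ?Y {x} * ?Xi1"
    unfolding A_def tII(1)[symmetric]
    by (rule Xi_remove_right) (use x fin tII ineqs Y0 in auto)
  have Xi2: "prod2 (g c) ?Y {z} * ?Xi2 = g c x z * (alpha lam ?m x * ?aL) * ?Xi1"
    by (rule Xi_extend_right) (use ineqs in auto)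
  have bL: "OmegaL c (insert z A) {x} (insert z (t (?m - 1))) (t k) =
            ?aL * (gam c z x * h c x z / prod2 (g c) ?Y {x})"
    unfolding tII(2,3) by (rule OmegaL_new_right) (use A finII dis in auto)
  have bR: "OmegaR c {x} (insert z A) (insert z (t (?m - 1))) (t k) =
            ?aR * (gam c x z * prod2 (h c) ?Y {x} / g c x z)"
    unfolding tII(2,3) by (rule OmegaR_new_right) (use A finII dis in auto)
  show ?R
    unfolding bR Xi gam_def using g_nonzero[OF c xz] h by simp
  \<comment> \<open>Both sides are compared after multiplication by this factor, which is not zero.\<close>
  have "prod2 (g c) ?Y {z} * (?Xi * (alpha lam ?m x * ?aL)
          - alpha lam ?m x * (?aL * (gam c z x * h c x z / prod2 (g c) ?Y {x})) * h c z x * ?Xi1)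
     = alpha lam ?m x * ?aL * ?Xi1 * (prod2 (g c) ?Y {z} * prod2 (h c) ?Y {x}
           - h c z x * prod2 (g c) ?Y {z} * g c z x / prod2 (g c) ?Y {x})"
    unfolding Xi gam_def using h by (simp add: algebra_simps)
  also have "\<dots> = prod2 (g c) ?Y {z} * ?Xi2"
    unfolding exchange_right[OF c xz Y] Xi2 by simp
  finally show ?L
    unfolding bL using gY by (simp only: mult_cancel_left) simp
qed

section \<open>Zero modes\<close>

text \<open>Identities for zero modes are proved by comparing limits at infinity, which are unique because
  this filter is nontrivial.\<close>

lemma at_infinity_complex_nontrivial: "(at_infinity :: complex filter) \<noteq> bot"
proof
  assume "(at_infinity :: complex filter) = bot"
  then have "eventually (\<lambda>_. False) (at_infinity :: complex filter)" by simp
  then obtain b where "\<And>x :: complex. b \<le> norm x \<Longrightarrow> False"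
    by (auto simp: eventually_at_infinity)
  from this[of "of_real \<bar>b\<bar>"] show False using abs_ge_self[of b] by simp
qed

context gl_model
begin

lemma tendsto_scale:
  assumes "(f \<longlongrightarrow> a) F" "(w \<longlongrightarrow> x) F"
  shows "((\<lambda>u. f u *s w u) \<longlongrightarrow> a *s x) F"
  using continuous_on_tendsto_compose[OF continuous_scale tendsto_Pair[OF assms]] by simp

lemma T_linear:
  assumes "i \<in> {1..n}" "j \<in> {1..n}" "u \<in> D"
  shows "T i j u (x + y) = T i j u x + T i j u y" "T i j u (r *s x) = r *s T i j u x"
  using linear_T[OF assms] by (simp_all add: Vector_Spaces.linear_iff)

lemma tendsto_T:
  assumes "i \<in> {1..n}" "j \<in> {1..n}" "v \<in> D" "(w \<longlongrightarrow> x) F"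
  shows "((\<lambda>u. T i j v (w u)) \<longlongrightarrow> T i j v x) F"
  using continuous_on_tendsto_compose[OF continuous_T[OF assms(1-3)] assms(4)] by simp

lemma zero_mode_limit:
  assumes "i \<in> {1..n}" "j \<in> {1..n}"
  shows "((\<lambda>u. (u / c) *s (T i j u w - (if i = j then chi i else 0) *s w)) \<longlongrightarrow> Tm i j 0 w)
           at_infinity"
  using expansion_T[OF assms, of 0 w] by simp

text \<open>The difference from the limit is \<open>c / u\<close> times an expression that tends to the zero mode.\<close>

lemma T_limit:
  assumes "i \<in> {1..n}" "j \<in> {1..n}"
  shows "((\<lambda>u. T i j u w) \<longlongrightarrow> (if i = j then chi i else 0) *s w) at_infinity"
proof -
  let ?d = "(if i = j then chi i else 0) *s w"
  have "((\<lambda>u. c * inverse u) \<longlongrightarrow> c * 0) at_infinity"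
    by (intro tendsto_mult tendsto_const tendsto_inverse_0)
  from tendsto_scale[OF this zero_mode_limit[OF assms, of w]]
  have "((\<lambda>u. (c * inverse u) *s (u / c) *s (T i j u w - ?d)) \<longlongrightarrow> 0) at_infinity"
    by simp
  moreover have "\<forall>\<^sub>F u in at_infinity. u \<noteq> (0 :: complex)"
    by (auto simp: eventually_at_infinity intro: exI[of _ 1])
  then have "\<forall>\<^sub>F u in at_infinity. (c * inverse u) *s (u / c) *s (T i j u w - ?d) = T i j u w - ?d"
    by eventually_elim (use c_nonzero in simp)
  ultimately have "((\<lambda>u. T i j u w - ?d) \<longlongrightarrow> 0) at_infinity"
    using tendsto_cong by fast
  from tendsto_add[OF this tendsto_const[of ?d]] show ?thesis by simp
qed

lemma zero_mode_linear:
  assumes "i \<in> {1..n}" "j \<in> {1..n}"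
  shows "Vector_Spaces.linear (*s) (*s) (Tm i j 0)"
proof -
  let ?d = "if i = j then chi i else 0"
  let ?f = "\<lambda>w u. (u / c) *s (T i j u w - ?d *s w)"
  have "Tm i j 0 (x + y) = Tm i j 0 x + Tm i j 0 y" for x y
  proof (rule tendsto_unique[OF at_infinity_complex_nontrivial zero_mode_limit[OF assms]])
    have "\<forall>\<^sub>F u in at_infinity. ?f x u + ?f y u = ?f (x + y) u"
      using D_infinity
      by eventually_elim (simp add: T_linear[OF assms] scale_right_distrib scale_right_diff_distrib)
    then show "(?f (x + y) \<longlongrightarrow> Tm i j 0 x + Tm i j 0 y) at_infinity"
      by (rule Lim_transform_eventually[rotated])
         (intro tendsto_add zero_mode_limit[OF assms])
  qed
  moreover have "Tm i j 0 (r *s x) = r *s Tm i j 0 x" for r x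
  proof (rule tendsto_unique[OF at_infinity_complex_nontrivial zero_mode_limit[OF assms]])
    have "\<forall>\<^sub>F u in at_infinity. r *s ?f x u = ?f (r *s x) u"
      using D_infinity
      by eventually_elim (simp add: T_linear[OF assms] scale_right_diff_distrib mult_ac)
    then show "(?f (r *s x) \<longlongrightarrow> r *s Tm i j 0 x) at_infinity"
      by (rule Lim_transform_eventually[rotated])
         (intro tendsto_scale tendsto_const zero_mode_limit[OF assms])
  qed
  ultimately show ?thesis
    using vector_space_axioms by (simp add: Vector_Spaces.linear_iff)
qed

text \<open>Multiply the commutation relation of \<open>T a b u\<close> and \<open>T i j v\<close> by \<open>u / c\<close> and let \<open>u\<close> tend to
  infinity. The constant term of \<open>T a b u\<close> may be subtracted, since it is a scalar; on the right
  \<open>u / (u - v)\<close> tends to \<open>1\<close> and the entries at \<open>u\<close> tend to a twist or to zero.\<close>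

lemma zero_mode_commutator:
  assumes ab: "a \<in> {1..n}" "b \<in> {1..n}" and ij: "i \<in> {1..n}" "j \<in> {1..n}" and v: "v \<in> D"
  shows "Tm a b 0 (T i j v w) - T i j v (Tm a b 0 w) =
           (if a = j then chi a else 0) *s T i b v w - (if i = b then chi i else 0) *s T a j v w"
proof (rule tendsto_unique[OF at_infinity_complex_nontrivial])
  let ?d = "if a = b then chi a else 0"
  let ?f = "\<lambda>w u. (u / c) *s (T a b u w - ?d *s w)"
  let ?L = "\<lambda>u. ?f (T i j v w) u - T i j v (?f w u)"
  let ?R = "\<lambda>u. (u / (u - v)) *s (T i b v (T a j u w) - T i b u (T a j v w))"
  show "(?L \<longlongrightarrow> Tm a b 0 (T i j v w) - T i j v (Tm a b 0 w)) at_infinity"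
    by (intro tendsto_diff zero_mode_limit tendsto_T ab ij v)
  have "((\<lambda>u. inverse (1 - v * inverse u)) \<longlongrightarrow> inverse (1 - v * 0)) at_infinity"
    by (intro tendsto_intros tendsto_inverse_0) simp
  moreover have "\<forall>\<^sub>F u in at_infinity. inverse (1 - v * inverse u) = u / (u - v)"
    unfolding eventually_at_infinity
  proof (intro exI allI impI)
    fix u :: complex assume "norm v + 1 \<le> norm u"
    then have "u \<noteq> 0" "u - v \<noteq> 0" using norm_ge_zero[of v] by (auto simp del: norm_ge_zero)
    then show "inverse (1 - v * inverse u) = u / (u - v)" by (simp add: field_simps)
  qed
  ultimately have lim: "((\<lambda>u. u / (u - v)) \<longlongrightarrow> 1) at_infinity"
    using tendsto_cong by fastforce
  have "(?R \<longlongrightarrow> 1 *s (T i b v ((if a = j then chi a else 0) *s w)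
            - (if i = b then chi i else 0) *s T a j v w)) at_infinity"
    by (intro tendsto_scale lim tendsto_diff T_limit tendsto_T ab ij v)
  then have R: "(?R \<longlongrightarrow> (if a = j then chi a else 0) *s T i b v w
            - (if i = b then chi i else 0) *s T a j v w) at_infinity"
    by (simp only: T_linear[OF ij(1) ab(2) v] scale_one)
  have "\<forall>\<^sub>F u in at_infinity. u \<noteq> v"
    unfolding eventually_at_infinity by (intro exI[of _ "norm v + 1"]) auto
  with D_infinity have "\<forall>\<^sub>F u in at_infinity. ?R u = ?L u"
  proof eventually_elim
    case (elim u)
    have "?L u = (u / c) *s (T a b u (T i j v w) - T i j v (T a b u w))"
      using module_hom.diff[OF Vector_Spaces.linear.axioms(3)[OF linear_T[OF ij v]]]
      by (simp add: T_linear[OF ij v] scale_right_diff_distrib mult_ac)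
    also have "\<dots> = (u / c) *s (c / (u - v)) *s (T i b v (T a j u w) - T i b u (T a j v w))"
      using commutator_T[OF ab ij elim(1) v elim(2)] by simp
    also have "\<dots> = ?R u" using c_nonzero by simp
    finally show ?case by simp
  qed
  with R show "(?L \<longlongrightarrow> (if a = j then chi a else 0) *s T i b v w
            - (if i = b then chi i else 0) *s T a j v w) at_infinity"
    by (rule Lim_transform_eventually)
qed

end

section \<open>The two recurrence steps\<close>

context bethe_vectors
begin

lemma zero_mode_on_bethe:
  assumes "admissible n c D lam t" "1 \<le> m" "m < n"
  shows "Tm (m + 1) m 0 (B t) =
         (\<Sum>x\<in>t m. (chi (m + 1) * (alpha lam m x * OmegaL c (t m - {x}) {x} (t (m - 1)) (t (m + 1)))
              - chi m * OmegaR c {x} (t m - {x}) (t (m - 1)) (t (m + 1))) *s B (t(m := t m - {x})))"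
proof -
  have "m \<le> n - 1" using assms by simp
  from action_zero_mode[OF assms(1,2) this] show ?thesis
    unfolding sum_partitions2_singleton by (simp add: prod1_def mult_ac)
qed

text \<open>The contribution of one entry \<open>T i j\<close> to the expansion, without the normalization.\<close>

definition rect_term :: "nat \<Rightarrow> nat \<Rightarrow> nat \<Rightarrow> nat \<Rightarrow> complex \<Rightarrow> params \<Rightarrow> 'v" where
  "rect_term l k i j z t =
     (\<Sum>(tI, tII, tIII) \<in> partitions3 n l k i j t.
        Xi c lam l k i j z tI tII tIII *s T i j z (B tII))"

text \<open>The recurrence with \<open>mu\<close> multiplied out. It is quantified over all \<open>t\<close>, since a step applies it
  also to smaller collections of parameters.\<close>

definition recurrence :: "nat \<Rightarrow> nat \<Rightarrow> bool" where
  "recurrence l k \<longleftrightarrow>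
     (\<forall>z t. generic_params n c D lam z t \<longrightarrow>
        mu c lam l k z t *s B (add_param l k z t) = (\<Sum>i=1..l. \<Sum>j=k..n. rect_term l k i j z t))"

lemma zero_mode_past_T:
  assumes gen: "generic_params n c D lam z t" and t': "\<And>s. t' s \<subseteq> t s" "t' m = t m"
    and m: "1 \<le> m" "m < n" and ij: "i \<in> {1..n}" "j \<in> {1..n}"
  shows "Tm (m + 1) m 0 (T i j z (B t')) =
     (\<Sum>x\<in>t m. (chi (m + 1) * (alpha lam m x * OmegaL c (t m - {x}) {x} (t' (m - 1)) (t' (m + 1)))
              - chi m * OmegaR c {x} (t m - {x}) (t' (m - 1)) (t' (m + 1)))
            *s T i j z (B (t'(m := t m - {x}))))
     + ((if m + 1 = j then chi (m + 1) else 0) *s T i m z (B t')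
        - (if i = m then chi m else 0) *s T (m + 1) j z (B t'))"
proof -
  have z: "z \<in> D" using gen by (simp add: generic_params_def)
  interpret Tz: Vector_Spaces.linear "(*s)" "(*s)" "T i j z"
    by (rule linear_T[OF ij z])
  have "admissible n c D lam t'"
    using generic_subset[OF gen t'(1)] by (rule generic_admissible)
  from zero_mode_on_bethe[OF this m]
  have "T i j z (Tm (m + 1) m 0 (B t')) =
     (\<Sum>x\<in>t m. (chi (m + 1) * (alpha lam m x * OmegaL c (t m - {x}) {x} (t' (m - 1)) (t' (m + 1)))
              - chi m * OmegaR c {x} (t m - {x}) (t' (m - 1)) (t' (m + 1)))
            *s T i j z (B (t'(m := t m - {x}))))"
    by (simp only: t'(2) Tz.sum Tz.scale)
  moreover have "m + 1 \<in> {1..n}" "m \<in> {1..n}" using m by auto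
  note zero_mode_commutator[OF this ij z, of "B t'"]
  then have "Tm (m + 1) m 0 (T i j z (B t')) = T i j z (Tm (m + 1) m 0 (B t'))
     + ((if m + 1 = j then chi (m + 1) else 0) *s T i m z (B t')
        - (if i = m then chi m else 0) *s T (m + 1) j z (B t'))"
    by (auto simp: algebra_simps)
  ultimately show ?thesis by simp
qed

text \<open>The terms of the commutator with \<open>T i j z\<close> shift \<open>j\<close> or \<open>i\<close> by one; all other terms remove some
  \<open>x\<close> of colour \<open>m\<close> from the vector. The hypothesis \<open>upd\<close> says how the coefficients of the latter
  split: into a multiple of the coefficient in the \<open>rect_term\<close> for the collection without \<open>x\<close>, and a
  part \<open>X\<close> that will belong to the next recurrence. Colour \<open>m\<close> is not divided by the
  partitions, which is why \<open>x\<close> ranges over all of \<open>t m\<close>.\<close>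

lemma zero_mode_rect_term:
  assumes gen: "generic_params n c D lam z t"
    and m: "1 \<le> l" "l \<le> m" "m \<le> k - 1" "k \<le> n" and ij: "i \<in> {1..n}" "j \<in> {1..n}"
    and upd: "\<And>tI tII tIII x. (tI, tII, tIII) \<in> partitions3 n l k i j t \<Longrightarrow> x \<in> t m \<Longrightarrow>
        Xi c lam l k i j z tI tII tIII *
          (chi (m + 1) * (alpha lam m x * OmegaL c (t m - {x}) {x} (tII (m - 1)) (tII (m + 1)))
              - chi m * OmegaR c {x} (t m - {x}) (tII (m - 1)) (tII (m + 1)))
        = b x * Xi c lam l k i j z tI (tII(m := t m - {x})) tIII + e * X x tI tII tIII"
  shows "Tm (m + 1) m 0 (rect_term l k i j z t) =
      (\<Sum>x\<in>t m. b x *s rect_term l k i j z (t(m := t m - {x})))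
    + e *s (\<Sum>x\<in>t m. \<Sum>(tI, tII, tIII) \<in> partitions3 n l k i j t.
                X x tI tII tIII *s T i j z (B (tII(m := t m - {x}))))
    + ((if m + 1 = j then chi (m + 1) else 0) *s
         (\<Sum>(tI, tII, tIII) \<in> partitions3 n l k i j t.
            Xi c lam l k i j z tI tII tIII *s T i m z (B tII))
      - (if i = m then chi m else 0) *s
         (\<Sum>(tI, tII, tIII) \<in> partitions3 n l k i j t.
            Xi c lam l k i j z tI tII tIII *s T (m + 1) j z (B tII)))"
proof -
  have mn: "1 \<le> m" "m < n" "m \<in> {1..<n}" using m by auto
  have dims: "m + 1 \<in> {1..n}" "m \<in> {1..n}" using mn by auto
  interpret E: Vector_Spaces.linear "(*s)" "(*s)" "Tm (m + 1) m 0"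
    by (rule zero_mode_linear[OF dims])
  let ?P = "partitions3 n l k i j t"
  let ?Xi = "Xi c lam l k i j z"
  let ?V = "\<lambda>x tII. T i j z (B (tII(m := t m - {x})))"
  let ?r = "\<lambda>tII. (if m + 1 = j then chi (m + 1) else 0) *s T i m z (B tII)
                - (if i = m then chi m else 0) *s T (m + 1) j z (B tII)"
  have one: "Tm (m + 1) m 0 (?Xi tI tII tIII *s T i j z (B tII)) =
      (\<Sum>x\<in>t m. b x *s (?Xi tI (tII(m := t m - {x})) tIII *s ?V x tII))
      + (\<Sum>x\<in>t m. e *s (X x tI tII tIII *s ?V x tII)) + ?Xi tI tII tIII *s ?r tII"
    if p: "(tI, tII, tIII) \<in> ?P" for tI tII tIII
  proof -
    have "tII s \<subseteq> t s" for s using partitions3_cover(1)[OF p, of s] by auto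
    moreover have "tII m = t m"
      using partitions3_cover(1)[OF p, of m] partitions3_I_empty[OF p gen, of m]
        partitions3_III_empty[OF p gen, of m] m by auto
    ultimately have "Tm (m + 1) m 0 (?Xi tI tII tIII *s T i j z (B tII)) =
       (\<Sum>x\<in>t m. (?Xi tI tII tIII *
          (chi (m + 1) * (alpha lam m x * OmegaL c (t m - {x}) {x} (tII (m - 1)) (tII (m + 1)))
              - chi m * OmegaR c {x} (t m - {x}) (tII (m - 1)) (tII (m + 1)))) *s ?V x tII)
        + ?Xi tI tII tIII *s ?r tII"
      by (simp only: E.scale zero_mode_past_T[OF gen _ _ mn(1,2) ij] scale_right_distrib
          scale_sum_right scale_scale)
    also have "(\<Sum>x\<in>t m. (?Xi tI tII tIII *
          (chi (m + 1) * (alpha lam m x * OmegaL c (t m - {x}) {x} (tII (m - 1)) (tII (m + 1)))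
              - chi m * OmegaR c {x} (t m - {x}) (tII (m - 1)) (tII (m + 1)))) *s ?V x tII) =
        (\<Sum>x\<in>t m. b x *s (?Xi tI (tII(m := t m - {x})) tIII *s ?V x tII)
            + e *s (X x tI tII tIII *s ?V x tII))"
      by (rule sum.cong[OF refl], subst upd[OF p]) (simp_all add: scale_left_distrib)
    finally show ?thesis by (simp only: sum.distrib)
  qed
  have upd': "rect_term l k i j z (t(m := t m - {x})) =
      (\<Sum>(tI, tII, tIII) \<in> ?P. ?Xi tI (tII(m := t m - {x})) tIII *s ?V x tII)" for x
    unfolding rect_term_def partitions3_eq
    by (rule sum_sized_partitions_update)
       (use mn m generic_finite[OF gen] in auto)
  have "Tm (m + 1) m 0 (rect_term l k i j z t) =
     (\<Sum>(tI, tII, tIII) \<in> ?P.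
      (\<Sum>x\<in>t m. b x *s (?Xi tI (tII(m := t m - {x})) tIII *s ?V x tII))
      + (\<Sum>x\<in>t m. e *s (X x tI tII tIII *s ?V x tII)) + ?Xi tI tII tIII *s ?r tII)"
    unfolding rect_term_def E.sum by (rule sum.cong) (auto simp only: one)
  also have "\<dots> =
     (\<Sum>x\<in>t m. \<Sum>(tI, tII, tIII) \<in> ?P. b x *s (?Xi tI (tII(m := t m - {x})) tIII *s ?V x tII))
     + (\<Sum>x\<in>t m. \<Sum>(tI, tII, tIII) \<in> ?P. e *s (X x tI tII tIII *s ?V x tII))
     + (\<Sum>(tI, tII, tIII) \<in> ?P. ?Xi tI tII tIII *s ?r tII)"
    unfolding split_def sum.distrib
    by (subst (1 2) sum.swap[of _ "t m"]) (rule refl)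
  finally show ?thesis
    unfolding upd'
    by (simp add: split_def scale_sum_right scale_right_diff_distrib sum_subtractf
        mult_ac)
qed

text \<open>The extracted parameters \<open>x\<close> of colour \<open>l\<close> turn the partitions for \<open>(l, k)\<close> into those for
  \<open>(l + 1, k)\<close>, with the same \<open>i\<close>. The missing terms, with row \<open>l + 1\<close>, come from the commutator
  with \<open>T l j z\<close>.\<close>

lemma zero_mode_rect_term_left:
  assumes gen: "generic_params n c D lam z t"
    and ineqs: "1 \<le> i" "i \<le> l" "l < k - 1" "k \<le> j" "j \<le> n"
  defines "b \<equiv> \<lambda>x. chi (l + 1) * (alpha lam l x *
                OmegaL c (insert z (t l - {x})) {x} (t (l - 1)) (insert z (t (l + 1))))
              - chi l * OmegaR c {x} (insert z (t l - {x})) (t (l - 1)) (insert z (t (l + 1)))"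
  shows "Tm (l + 1) l 0 (rect_term l k i j z t) =
      (\<Sum>x\<in>t l. (b x * h c x z) *s rect_term l k i j z (t(l := t l - {x})))
      - chi l *s (rect_term (l + 1) k i j z t
                  + (if i = l then rect_term (l + 1) k (l + 1) j z t else 0))"
proof -
  let ?P = "partitions3 n l k i j t"
  let ?X = "\<lambda>x tI tII tIII. Xi c lam (l + 1) k i j z (tI(l := {x})) (tII(l := t l - {x})) tIII"
  have new: "rect_term (l + 1) k i j z t =
      (\<Sum>x\<in>t l. \<Sum>(tI, tII, tIII) \<in> ?P. ?X x tI tII tIII *s T i j z (B (tII(l := t l - {x}))))"
  proof -
    \<comment> \<open>The condition \<open>i \<le> l\<close> makes the new cardinality at colour \<open>l\<close> equal to \<open>1\<close>.\<close>
    have "(\<lambda>s. if s < l + 1 then Theta (int s - int i) else 0) =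
          (\<lambda>s. if s < l then Theta (int s - int i) else 0)(l := 1)"
      using ineqs by (auto simp: fun_eq_iff Theta_def)
    then show ?thesis
      unfolding rect_term_def partitions3_eq
      by (simp only:) (rule sum_sized_partitions_extend_left;
         use ineqs generic_finite[OF gen] in auto)
  qed
  have diag: "(\<Sum>(tI, tII, tIII) \<in> ?P. Xi c lam l k i j z tI tII tIII *s T (l + 1) j z (B tII)) =
      rect_term (l + 1) k (l + 1) j z t" if "i = l"
  proof -
    \<comment> \<open>For these two pairs of indices all prescribed cardinalities of \<open>tI\<close> are zero.\<close>
    have "partitions3 n (l + 1) k (l + 1) j t = ?P"
      unfolding partitions3_def Theta_def that by (intro Collect_cong) auto
    moreover have "Xi c lam l k l j z tI tII tIII = Xi c lam (l + 1) k (l + 1) j z tI tII tIII"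
      if p: "(tI, tII, tIII) \<in> partitions3 n l k l j t" for tI tII tIII
    proof -
      have "tI (l - 1) = {}" "tI l = {}"
        using ineqs by (auto intro!: partitions3_I_empty[OF p gen])
      then show ?thesis by (simp add: Xi_def)
    qed
    ultimately show ?thesis
      unfolding rect_term_def that by (intro sum.cong) auto
  qed
  have "Tm (l + 1) l 0 (rect_term l k i j z t) =
      (\<Sum>x\<in>t l. (b x * h c x z) *s rect_term l k i j z (t(l := t l - {x})))
    + (- chi l) *s (\<Sum>x\<in>t l. \<Sum>(tI, tII, tIII) \<in> ?P. ?X x tI tII tIII *s T i j z (B (tII(l := t l - {x}))))
    + ((if l + 1 = j then chi (l + 1) else 0) *s
         (\<Sum>(tI, tII, tIII) \<in> ?P. Xi c lam l k i j z tI tII tIII *s T i l z (B tII))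
      - (if i = l then chi l else 0) *s
         (\<Sum>(tI, tII, tIII) \<in> ?P. Xi c lam l k i j z tI tII tIII *s T (l + 1) j z (B tII)))"
  proof (rule zero_mode_rect_term[OF gen])
    fix tI tII tIII x
    assume p: "(tI, tII, tIII) \<in> ?P" and x: "x \<in> t l"
    note coefficients_left[OF gen c_nonzero p ineqs(1-3) x]
    then show "Xi c lam l k i j z tI tII tIII *
          (chi (l + 1) * (alpha lam l x * OmegaL c (t l - {x}) {x} (tII (l - 1)) (tII (l + 1)))
              - chi l * OmegaR c {x} (t l - {x}) (tII (l - 1)) (tII (l + 1)))
        = b x * h c x z * Xi c lam l k i j z tI (tII(l := t l - {x})) tIII
          + - chi l * ?X x tI tII tIII"
      unfolding b_def by algebra
  qed (use ineqs in auto)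
  from this[folded new] show ?thesis
    using ineqs diag by (auto simp: scale_right_distrib)
qed

lemma zero_mode_rect_term_right:
  assumes gen: "generic_params n c D lam z t"
    and ineqs: "1 \<le> i" "i \<le> l" "l < k - 1" "k \<le> j" "j \<le> n"
  defines "b \<equiv> \<lambda>x. chi k * (alpha lam (k - 1) x *
                OmegaL c (insert z (t (k - 1) - {x})) {x} (insert z (t (k - 1 - 1))) (t k))
              - chi (k - 1) * OmegaR c {x} (insert z (t (k - 1) - {x})) (insert z (t (k - 1 - 1))) (t k)"
  shows "Tm k (k - 1) 0 (rect_term l k i j z t) =
      (\<Sum>x\<in>t (k - 1). (b x * h c z x) *s rect_term l k i j z (t(k - 1 := t (k - 1) - {x})))
      + chi k *s (rect_term l (k - 1) i j z t
                  + (if j = k then rect_term l (k - 1) i (k - 1) z t else 0))"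
proof -
  let ?P = "partitions3 n l k i j t"
  let ?X = "\<lambda>x tI tII tIII.
      Xi c lam l (k - 1) i j z tI (tII(k - 1 := t (k - 1) - {x})) (tIII(k - 1 := {x}))"
  have k: "k - 1 + 1 = k" using ineqs by simp
  have new: "rect_term l (k - 1) i j z t =
      (\<Sum>x\<in>t (k - 1). \<Sum>(tI, tII, tIII) \<in> ?P.
          ?X x tI tII tIII *s T i j z (B (tII(k - 1 := t (k - 1) - {x}))))"
  proof -
    \<comment> \<open>The condition \<open>k \<le> j\<close> makes the new cardinality at colour \<open>k - 1\<close> equal to \<open>1\<close>.\<close>
    have "(\<lambda>s. if s \<le> k - 1 - 1 then 0 else Theta (int j - int s - 1)) =
          (\<lambda>s. if s \<le> k - 1 then 0 else Theta (int j - int s - 1))(k - 1 := 1)"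
      using ineqs by (auto simp: fun_eq_iff Theta_def)
    then show ?thesis
      unfolding rect_term_def partitions3_eq
      by (simp only:) (rule sum_sized_partitions_extend_right;
         use ineqs generic_finite[OF gen] in auto)
  qed
  have diag: "(\<Sum>(tI, tII, tIII) \<in> ?P. Xi c lam l k i j z tI tII tIII *s T i (k - 1) z (B tII)) =
      rect_term l (k - 1) i (k - 1) z t" if "j = k"
  proof -
    \<comment> \<open>For these two pairs of indices all prescribed cardinalities of \<open>tIII\<close> are zero.\<close>
    have "partitions3 n l (k - 1) i (k - 1) t = ?P"
      unfolding partitions3_def Theta_def that using ineqs by (intro Collect_cong) auto
    moreover have "Xi c lam l k i k z tI tII tIII = Xi c lam l (k - 1) i (k - 1) z tI tII tIII"
      if p: "(tI, tII, tIII) \<in> partitions3 n l k i k t" for tI tII tIII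
    proof -
      have "tIII (k - 1) = {}" "tIII k = {}"
        using ineqs by (auto intro!: partitions3_III_empty[OF p gen])
      then show ?thesis by (simp add: Xi_def)
    qed
    ultimately show ?thesis
      unfolding rect_term_def that by (intro sum.cong) auto
  qed
  have "Tm (k - 1 + 1) (k - 1) 0 (rect_term l k i j z t) =
      (\<Sum>x\<in>t (k - 1). (b x * h c z x) *s rect_term l k i j z (t(k - 1 := t (k - 1) - {x})))
    + chi k *s (\<Sum>x\<in>t (k - 1). \<Sum>(tI, tII, tIII) \<in> ?P.
          ?X x tI tII tIII *s T i j z (B (tII(k - 1 := t (k - 1) - {x}))))
    + ((if k - 1 + 1 = j then chi (k - 1 + 1) else 0) *s
         (\<Sum>(tI, tII, tIII) \<in> ?P. Xi c lam l k i j z tI tII tIII *s T i (k - 1) z (B tII))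
      - (if i = k - 1 then chi (k - 1) else 0) *s
         (\<Sum>(tI, tII, tIII) \<in> ?P. Xi c lam l k i j z tI tII tIII *s T (k - 1 + 1) j z (B tII)))"
  proof (rule zero_mode_rect_term[OF gen])
    fix tI tII tIII x
    assume p: "(tI, tII, tIII) \<in> ?P" and x: "x \<in> t (k - 1)"
    note coefficients_right[OF gen c_nonzero p ineqs(1-4) x]
    then show "Xi c lam l k i j z tI tII tIII *
          (chi (k - 1 + 1) * (alpha lam (k - 1) x *
               OmegaL c (t (k - 1) - {x}) {x} (tII (k - 1 - 1)) (tII (k - 1 + 1)))
            - chi (k - 1) * OmegaR c {x} (t (k - 1) - {x}) (tII (k - 1 - 1)) (tII (k - 1 + 1)))
        = b x * h c z x * Xi c lam l k i j z tI (tII(k - 1 := t (k - 1) - {x})) tIII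
          + chi k * ?X x tI tII tIII"
      unfolding b_def k by algebra
  qed (use ineqs in auto)
  from this[folded new, unfolded k] show ?thesis
    using ineqs diag by (auto simp: scale_right_distrib)
qed

lemma generic_remove:
  "generic_params n c D lam z t \<Longrightarrow> generic_params n c D lam z (t(m := t m - {x}))"
  by (erule generic_subset) auto

text \<open>The parameter removed by the zero mode is either \<open>z\<close> or a member of \<open>t m\<close>.\<close>

lemma zero_mode_on_added_parameter:
  assumes gen: "generic_params n c D lam z t" and ineqs: "1 \<le> l" "l \<le> m" "m \<le> k - 1" "k \<le> n"
  defines "u \<equiv> add_param l k z t"
  shows "Tm (m + 1) m 0 (B u) =
      (chi (m + 1) * (alpha lam m z * OmegaL c (t m) {z} (u (m - 1)) (u (m + 1)))
         - chi m * OmegaR c {z} (t m) (u (m - 1)) (u (m + 1))) *s B (u(m := t m))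
      + (\<Sum>x\<in>t m. (chi (m + 1) * (alpha lam m x *
                OmegaL c (insert z (t m - {x})) {x} (u (m - 1)) (u (m + 1)))
            - chi m * OmegaR c {x} (insert z (t m - {x})) (u (m - 1)) (u (m + 1)))
          *s B (add_param l k z (t(m := t m - {x}))))"
proof -
  have fresh: "z \<notin> t m" and fin: "finite (t m)"
    by (rule generic_fresh[OF gen], rule generic_finite[OF gen])
  have um: "u m = insert z (t m)"
    using ineqs by (simp add: u_def add_param_def)
  have "insert z (t m) - {x} = insert z (t m - {x})" if "x \<in> t m" for x
    using that fresh by auto
  moreover have "u(m := insert z (t m - {x})) = add_param l k z (t(m := t m - {x}))" for x
    using ineqs by (auto simp: u_def add_param_def fun_eq_iff)
  ultimately show ?thesis
    using zero_mode_on_bethe[OF admissible_add_param[OF gen c_nonzero ineqs(1,4)], of m] ineqs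
      fresh fin
    by (simp add: u_def[symmetric] um cong: sum.cong)
qed

text \<open>Applying the zero mode to both sides of the recurrence gives, for each \<open>x\<close>, a vector with \<open>z\<close>
  added and \<open>x\<close> removed on the left. By the recurrence for the collection without \<open>x\<close> it equals the
  corresponding sum on the right, and only the vector \<open>Z\<close> lacking \<open>z\<close> in colour \<open>m\<close> remains.\<close>

lemma zero_mode_on_recurrence:
  assumes rec: "recurrence l k" and gen: "generic_params n c D lam z t"
    and m: "1 \<le> m" "m < n"
    and added: "Tm (m + 1) m 0 (B (add_param l k z t)) =
        d *s Z + (\<Sum>x\<in>t m. b x *s B (add_param l k z (t(m := t m - {x}))))"
    and mu: "\<And>x. x \<in> t m \<Longrightarrow> mu c lam l k z t = w x * mu c lam l k z (t(m := t m - {x}))"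
    and terms: "\<And>i j. i \<in> {1..l} \<Longrightarrow> j \<in> {k..n} \<Longrightarrow>
        Tm (m + 1) m 0 (rect_term l k i j z t) =
          (\<Sum>x\<in>t m. (b x * w x) *s rect_term l k i j z (t(m := t m - {x}))) + e *s N i j"
  shows "(mu c lam l k z t * d) *s Z = e *s (\<Sum>i=1..l. \<Sum>j=k..n. N i j)"
proof -
  let ?mu = "mu c lam l k z t"
  have dims: "m + 1 \<in> {1..n}" "m \<in> {1..n}" using m by auto
  interpret E: Vector_Spaces.linear "(*s)" "(*s)" "Tm (m + 1) m 0"
    by (rule zero_mode_linear[OF dims])
  let ?S = "\<Sum>x\<in>t m. \<Sum>i=1..l. \<Sum>j=k..n. (b x * w x) *s rect_term l k i j z (t(m := t m - {x}))"
  have rec_x: "(?mu * b x) *s B (add_param l k z (t(m := t m - {x}))) =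
      (\<Sum>i=1..l. \<Sum>j=k..n. (b x * w x) *s rect_term l k i j z (t(m := t m - {x})))"
    if "x \<in> t m" for x
  proof -
    have "?mu * b x = (b x * w x) * mu c lam l k z (t(m := t m - {x}))"
      using mu[OF that] by simp
    then show ?thesis
      using rec generic_remove[OF gen, of m x]
      by (simp only: recurrence_def scale_scale[symmetric] scale_sum_right)
  qed
  have "Tm (m + 1) m 0 (?mu *s B (add_param l k z t)) = (?mu * d) *s Z + ?S"
    unfolding E.scale added scale_right_distrib scale_sum_right scale_scale
    by (simp only: rec_x cong: sum.cong)
  moreover have "Tm (m + 1) m 0 (?mu *s B (add_param l k z t)) =
      (\<Sum>i=1..l. \<Sum>j=k..n. Tm (m + 1) m 0 (rect_term l k i j z t))"
    by (subst rec[unfolded recurrence_def, rule_format, OF gen]) (simp only: E.sum)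
  moreover have "\<dots> = (\<Sum>i=1..l. \<Sum>j=k..n.
      (\<Sum>x\<in>t m. (b x * w x) *s rect_term l k i j z (t(m := t m - {x}))) + e *s N i j)"
    by (intro sum.cong refl terms)
  moreover have "\<dots> = ?S + e *s (\<Sum>i=1..l. \<Sum>j=k..n. N i j)"
  proof -
    have swap: "(\<Sum>i=1..l. \<Sum>j=k..n. \<Sum>x\<in>t m. F i j x) = (\<Sum>x\<in>t m. \<Sum>i=1..l. \<Sum>j=k..n. F i j x)"
      for F :: "nat \<Rightarrow> nat \<Rightarrow> complex \<Rightarrow> 'v"
      by (simp only: sum.swap[of _ "t m"])
    show ?thesis
      unfolding sum.distrib swap scale_sum_right ..
  qed
  ultimately show ?thesis by simp
qed

text \<open>The assumption \<open>l < k - 1\<close> ensures that \<open>z\<close> is also present in colour \<open>l + 1\<close>, so that the vector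
  without \<open>z\<close> in colour \<open>l\<close> appears with a coefficient proportional to \<open>chi l\<close> alone. As \<open>chi l\<close> is
  not zero, it can be cancelled.\<close>

lemma recurrence_step_left:
  assumes rec: "recurrence l k" and ineqs: "1 \<le> l" "l < k - 1" "k \<le> n"
  shows "recurrence (l + 1) k"
  unfolding recurrence_def
proof (intro allI impI)
  fix z t assume gen: "generic_params n c D lam z t"
  let ?N = "\<lambda>i j. rect_term (l + 1) k i j z t
                   + (if i = l then rect_term (l + 1) k (l + 1) j z t else 0)"
  let ?b = "\<lambda>x. chi (l + 1) * (alpha lam l x *
                OmegaL c (insert z (t l - {x})) {x} (t (l - 1)) (insert z (t (l + 1))))
              - chi l * OmegaR c {x} (insert z (t l - {x})) (t (l - 1)) (insert z (t (l + 1)))"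
  let ?u = "add_param l k z t" and ?Z = "B (add_param (l + 1) k z t)"
  have fin: "finite (t s)" for s by (rule generic_finite[OF gen])
  have u: "?u (l - 1) = t (l - 1)" "?u (l + 1) = insert z (t (l + 1))"
    "?u(l := t l) = add_param (l + 1) k z t"
    using ineqs by (auto simp: add_param_def fun_eq_iff)
  have "(mu c lam l k z t * (- (chi l * OmegaR c {z} (t l) (t (l - 1)) (insert z (t (l + 1))))))
          *s ?Z = (- chi l) *s (\<Sum>i=1..l. \<Sum>j=k..n. ?N i j)"
  proof (rule zero_mode_on_recurrence[OF rec gen, where b = ?b and w = "\<lambda>x. h c x z"])
    show "Tm (l + 1) l 0 (B ?u) =
        (- (chi l * OmegaR c {z} (t l) (t (l - 1)) (insert z (t (l + 1))))) *s ?Z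
        + (\<Sum>x\<in>t l. ?b x *s B (add_param l k z (t(l := t l - {x}))))"
      using zero_mode_on_added_parameter[OF gen ineqs(1) order_refl _ ineqs(3)] ineqs
      unfolding u by (simp add: OmegaL_vanishes fin)
    show "mu c lam l k z t = h c x z * mu c lam l k z (t(l := t l - {x}))" if "x \<in> t l" for x
      by (rule mu_remove_left[where t = t, OF fin that ineqs(1,2)])
    show "Tm (l + 1) l 0 (rect_term l k i j z t) =
        (\<Sum>x\<in>t l. (?b x * h c x z) *s rect_term l k i j z (t(l := t l - {x}))) + (- chi l) *s ?N i j"
      if "i \<in> {1..l}" "j \<in> {k..n}" for i j
      using zero_mode_rect_term_left[OF gen, of i l k j] that ineqs by simp
  qed (use ineqs in auto)
  moreover have "mu c lam l k z t * (- (chi l * OmegaR c {z} (t l) (t (l - 1)) (insert z (t (l + 1)))))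
      = - chi l * mu c lam (l + 1) k z t"
    unfolding OmegaR_mu[OF gen c_nonzero, symmetric] by simp
  moreover have "(\<Sum>i=1..l. \<Sum>j=k..n. ?N i j) = (\<Sum>i=1..l+1. \<Sum>j=k..n. rect_term (l + 1) k i j z t)"
  proof -
    have "(\<Sum>i=1..l. \<Sum>j=k..n. if i = l then F j else 0) = (\<Sum>j=k..n. F j)" for F :: "nat \<Rightarrow> 'v"
      using ineqs by (subst sum.swap) simp
    then show ?thesis
      using ineqs unfolding sum.distrib by simp
  qed
  ultimately have "(- chi l) *s (mu c lam (l + 1) k z t *s ?Z) =
      (- chi l) *s (\<Sum>i=1..l+1. \<Sum>j=k..n. rect_term (l + 1) k i j z t)"
    by (simp only: scale_scale)
  moreover have "- chi l \<noteq> 0" using chi_nonzero[of l] ineqs by simp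
  ultimately show "mu c lam (l + 1) k z t *s ?Z = (\<Sum>i=1..l+1. \<Sum>j=k..n. rect_term (l + 1) k i j z t)"
    by (simp only: scale_cancel_left) simp
qed

lemma recurrence_step_right:
  assumes rec: "recurrence l k" and ineqs: "1 \<le> l" "l < k - 1" "k \<le> n"
  shows "recurrence l (k - 1)"
  unfolding recurrence_def
proof (intro allI impI)
  fix z t assume gen: "generic_params n c D lam z t"
  let ?m = "k - 1"
  let ?N = "\<lambda>i j. rect_term l ?m i j z t + (if j = k then rect_term l ?m i ?m z t else 0)"
  let ?b = "\<lambda>x. chi k * (alpha lam ?m x *
                OmegaL c (insert z (t ?m - {x})) {x} (insert z (t (?m - 1))) (t k))
              - chi ?m * OmegaR c {x} (insert z (t ?m - {x})) (insert z (t (?m - 1))) (t k)"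
  let ?d = "chi k * (alpha lam ?m z * OmegaL c (t ?m) {z} (insert z (t (?m - 1))) (t k))"
  let ?u = "add_param l k z t" and ?Z = "B (add_param l ?m z t)"
  have fin: "finite (t s)" for s by (rule generic_finite[OF gen])
  have k: "?m + 1 = k" using ineqs by simp
  have u: "?u (?m - 1) = insert z (t (?m - 1))" "?u k = t k"
    "?u(?m := t ?m) = add_param l ?m z t"
    using ineqs by (auto simp: add_param_def fun_eq_iff)
  have "(mu c lam l k z t * ?d) *s ?Z = chi k *s (\<Sum>i=1..l. \<Sum>j=k..n. ?N i j)"
  proof (rule zero_mode_on_recurrence[OF rec gen, where b = ?b and w = "\<lambda>x. h c z x" and m = ?m])
    show "Tm (?m + 1) ?m 0 (B ?u) =
        ?d *s ?Z + (\<Sum>x\<in>t ?m. ?b x *s B (add_param l k z (t(?m := t ?m - {x}))))"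
      using zero_mode_on_added_parameter[OF gen ineqs(1) _ order_refl ineqs(3)] ineqs
      unfolding k u by (simp add: OmegaR_vanishes fin)
    show "mu c lam l k z t = h c z x * mu c lam l k z (t(?m := t ?m - {x}))" if "x \<in> t ?m" for x
      by (rule mu_remove_right[where t = t, OF fin that ineqs(1,2)])
    show "Tm (?m + 1) ?m 0 (rect_term l k i j z t) =
        (\<Sum>x\<in>t ?m. (?b x * h c z x) *s rect_term l k i j z (t(?m := t ?m - {x}))) + chi k *s ?N i j"
      if "i \<in> {1..l}" "j \<in> {k..n}" for i j
      unfolding k by (rule zero_mode_rect_term_right[OF gen]) (use that ineqs in auto)
  qed (use ineqs in auto)
  moreover have "mu c lam l k z t * ?d = chi k * mu c lam l ?m z t"
    using OmegaL_mu[OF gen c_nonzero _ ineqs(3), of l] ineqs by simp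
  moreover have "(\<Sum>i=1..l. \<Sum>j=k..n. ?N i j) = (\<Sum>i=1..l. \<Sum>j=?m..n. rect_term l ?m i j z t)"
  proof (rule sum.cong[OF refl])
    fix i
    have "{?m..n} = insert ?m {k..n}" "?m \<notin> {k..n}" using ineqs by auto
    then show "(\<Sum>j=k..n. ?N i j) = (\<Sum>j=?m..n. rect_term l ?m i j z t)"
      using ineqs unfolding sum.distrib by (simp add: add.commute)
  qed
  ultimately have "chi k *s (mu c lam l ?m z t *s ?Z) =
      chi k *s (\<Sum>i=1..l. \<Sum>j=?m..n. rect_term l ?m i j z t)"
    by (simp only: scale_scale)
  moreover have "chi k \<noteq> 0" using chi_nonzero[of k] ineqs by simp
  ultimately show "mu c lam l ?m z t *s ?Z = (\<Sum>i=1..l. \<Sum>j=?m..n. rect_term l ?m i j z t)"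
    by (simp only: scale_cancel_left) simp
qed

section \<open>The rectangular recurrence\<close>

text \<open>No parameter can be extracted here, and the single term is the action of \<open>T 1 n z\<close>.\<close>

lemma recurrence_base: "recurrence 1 n"
  unfolding recurrence_def
proof (intro allI impI)
  fix z t assume gen: "generic_params n c D lam z t"
  have "partitions3 n 1 n 1 n t = {(\<lambda>_. {}, t, \<lambda>_. {})}" (is "?P = _")
  proof (intro equalityI subsetI)
    fix p assume "p \<in> ?P"
    moreover obtain tI tII tIII where "p = (tI, tII, tIII)" by (cases p)
    ultimately have p: "(tI, tII, tIII) \<in> ?P" "p = (tI, tII, tIII)" by simp_all
    have "tI s = {}" for s by (rule partitions3_I_empty[OF p(1) gen]) auto
    moreover have "tIII s = {}" for s by (rule partitions3_III_empty[OF p(1) gen]) auto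
    ultimately show "p \<in> {(\<lambda>_. {}, t, \<lambda>_. {})}"
      using partitions3_cover(1)[OF p(1)] p(2) by (auto simp: fun_eq_iff)
  next
    fix p :: "params \<times> params \<times> params"
    assume "p \<in> {(\<lambda>_. {}, t, \<lambda>_. {})}"
    then show "p \<in> ?P" by (auto simp: partitions3_def)
  qed
  then have "rect_term 1 n 1 n z t = T 1 n z (B t)"
    by (simp add: rect_term_def Xi_def)
  moreover have "T 1 n z (B t) = mu c lam 1 n z t *s B (add_param 1 n z t)"
    using admissible_add_param[OF gen c_nonzero, of 1 n] generic_fresh[OF gen]
    by (intro action_T1n) auto
  ultimately show "mu c lam 1 n z t *s B (add_param 1 n z t) =
      (\<Sum>i=1..1. \<Sum>j=n..n. rect_term 1 n i j z t)"
    by simp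
qed

text \<open>Raising the first index at \<open>k = n\<close> and then lowering the second one keeps the first below the
  second throughout.\<close>

lemma recurrence_all:
  assumes "1 \<le> l" "l < k" "k \<le> n"
  shows "recurrence l k"
proof -
  have full: "recurrence l n" if "1 \<le> l" "l < n" for l
    using that
  proof (induction l rule: dec_induct)
    case base
    show ?case by (rule recurrence_base)
  next
    case (step l)
    then show ?case using recurrence_step_left[of l n] by simp
  qed
  from assms(3,2) show ?thesis
  proof (induction k rule: inc_induct)
    case base
    then show ?case using full assms(1) by simp
  next
    case (step k)
    then show ?case using recurrence_step_right[of l "Suc k"] assms(1) by simp
  qed
qed

end

theorem theorem3p1:
  fixes scale :: "complex \<Rightarrow> 'v::{topological_ab_group_add,t2_space} \<Rightarrow> 'v"
    and n l k :: nat
    and c z :: complex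
    and chi :: "nat \<Rightarrow> complex"
    and D :: "complex set"
    and T :: "nat \<Rightarrow> nat \<Rightarrow> complex \<Rightarrow> 'v \<Rightarrow> 'v"
    and Tm :: "nat \<Rightarrow> nat \<Rightarrow> nat \<Rightarrow> 'v \<Rightarrow> 'v"
    and vac :: 'v
    and lam :: "nat \<Rightarrow> complex \<Rightarrow> complex"
    and B :: "params \<Rightarrow> 'v"
    and t :: params
  assumes "bethe_vectors scale n c chi D T Tm vac lam B"
    and "1 \<le> l" and "l < k" and "k \<le> n"
    and "generic_params n c D lam z t"
  shows "Zop l k z B t = B (\<lambda>s. if s \<in> {l..k - 1} then t s \<union> {z} else t s) \<and>
    B (\<lambda>s. if s \<in> {l..k - 1} then t s \<union> {z} else t s) =
      scale (1 / mu c lam l k z t)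
        (\<Sum>i=1..l. \<Sum>j=k..n. \<Sum>(tI, tII, tIII) \<in> partitions3 n l k i j t.
           scale (Xi c lam l k i j z tI tII tIII) (T i j z (B tII)))"
proof -
  interpret bethe_vectors scale n c chi D T Tm vac lam B by (rule assms(1))
  have u: "(\<lambda>s. if s \<in> {l..k - 1} then t s \<union> {z} else t s) = add_param l k z t"
    by (auto simp: add_param_def)
  have "mu c lam l k z t \<noteq> 0"
    using mu_nonzero[OF assms(5) c_nonzero] assms(2-4) by simp
  moreover have "scale (mu c lam l k z t) (B (add_param l k z t)) =
      (\<Sum>i=1..l. \<Sum>j=k..n. rect_term l k i j z t)"
    using recurrence_all[OF assms(2-4)] assms(5) by (simp add: recurrence_def)
  ultimately have "B (add_param l k z t) =
      scale (1 / mu c lam l k z t) (\<Sum>i=1..l. \<Sum>j=k..n. rect_term l k i j z t)"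
    by (metis scale_scale nonzero_eq_divide_eq scale_one)
  then show ?thesis
    unfolding u by (simp add: Zop_def rect_term_def)
qed

end
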